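(* Let $(V,\ell)$ be an $L_\infty$-algebra, $u_0$ a Maurer–Cartan element and $u_t\subset D_\ell$ a deformation of $u_0$. Then for every $k\geq0$, $Obs^k(u_t)=0$ in $H^1(V,\ell_1^{u_0})$, i.e. $Obs^k(u_t)\in\operatorname{im}(\ell_1^{u_0}:V_0\to V_1)$.
   Context: $V=\bigoplus_{i\in\mathbb{Z}}V_i$ real graded vector space, finite-dimensional topologies. An $L_\infty$-algebra is a sequence $\ell=(\ell_k)_{k\geq0}$ of graded symmetric $k$-linear degree-$1$ maps, $\ell_0=0$, satisfying the $L_\infty$ Jacobi identities. For $u\in V_0$, $\ell^u_p(v_1,\ldots,v_p)=\sum_{k\geq0}\frac1{k!}\ell_{p+k}(u,\ldots,u,v_1,\ldots,v_p)$; $D_\ell$ is the interior of the convergence set; $MC(u)=\ell^u_0$; Maurer–Cartan elements are $u\in D_\ell$ with $MC(u)=0$, for which $\ell_1^u\circ\ell_1^u=0$. A deformation of $u_0$ is a smooth path $u_t\subset D_\ell$ ($t$ in an interval containing $0$) with $u_t|_{t=0}=u_0$ and $MC(u_t)=0$ for all $t$. With $u_0^r=\partial^r_{t=0}u_t$, $Obs^k(u_t)=\sum_{i=2}^{k+1}\sum_{\vec r_i=k+1}\frac{(k+1)!}{r_1!\cdots r_i!}\frac1{i!}\ell_i^{u_0}(u_0^{r_1}\odot\cdots\odot u_0^{r_i})$, the inner sum over tuples of positive integers with sum $k+1$. *)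

theory Defs
  imports "HOL-Analysis.Analysis"
begin

text \<open>A set U is open iff its trace on every finite-dimensional subspace span B
  (B finite) is open in the Euclidean topology of that subspace. The ambient norm of
  'v is only used to name the Euclidean topology of finite-dimensional subspaces,
  which does not depend on the chosen norm.\<close>

definition fin_open :: "'v::real_normed_vector set \<Rightarrow> bool" where
  "fin_open U \<longleftrightarrow> (\<forall>B. finite B \<longrightarrow> openin (top_of_set (span B)) (U \<inter> span B))"

lemma istopology_fin_open: "istopology (fin_open :: 'v::real_normed_vector set \<Rightarrow> bool)"
  unfolding istopology_def
proof safe
  fix S T :: "'v::real_normed_vector set" assume "fin_open S" "fin_open T"
  then show "fin_open (S \<inter> T)"
    unfolding fin_open_def
  proof (intro allI impI)
    fix B :: "'v set" assume "finite B"
    then have "openin (top_of_set (span B)) ((S \<inter> span B) \<inter> (T \<inter> span B))"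
      using \<open>fin_open S\<close> \<open>fin_open T\<close> unfolding fin_open_def
      by (meson openin_Int)
    moreover have "(S \<inter> span B) \<inter> (T \<inter> span B) = S \<inter> T \<inter> span B" by blast
    ultimately show "openin (top_of_set (span B)) (S \<inter> T \<inter> span B)" by simp
  qed
next
  fix K :: "'v::real_normed_vector set set" assume K: "\<forall>S\<in>K. fin_open S"
  show "fin_open (\<Union>K)"
    unfolding fin_open_def
  proof (intro allI impI)
    fix B :: "'v set" assume "finite B"
    then have "openin (top_of_set (span B)) (\<Union>S\<in>K. S \<inter> span B)"
      using K unfolding fin_open_def by (intro openin_Union) auto
    moreover have "(\<Union>S\<in>K. S \<inter> span B) = \<Union>K \<inter> span B" by blast
    ultimately show "openin (top_of_set (span B)) (\<Union>K \<inter> span B)" by simp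
  qed
qed

definition ftop :: "'v::real_normed_vector topology" where
  "ftop = topology fin_open"

definition graded_space :: "(int \<Rightarrow> 'v::real_vector set) \<Rightarrow> bool" where
  "graded_space V \<longleftrightarrow> (\<forall>i. subspace (V i)) \<and>
     (\<forall>v. \<exists>!c::int \<Rightarrow> 'v. finite {i. c i \<noteq> 0} \<and> (\<forall>i. c i \<in> V i) \<and>
                v = (\<Sum>i\<in>{i. c i \<noteq> 0}. c i))"

definition koszul_sign :: "int list \<Rightarrow> (nat \<Rightarrow> nat) \<Rightarrow> real" where
  "koszul_sign ds \<sigma> = (-1) ^ card {(a, b). a < b \<and> b < length ds \<and> \<sigma> a > \<sigma> b \<and>
                                     odd (ds ! \<sigma> a) \<and> odd (ds ! \<sigma> b)}"

definition unshuffles :: "nat \<Rightarrow> nat \<Rightarrow> (nat \<Rightarrow> nat) set" where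
  "unshuffles i n = {\<sigma>. \<sigma> permutes {..<n} \<and>
       (\<forall>a b. a < b \<and> b < i \<longrightarrow> \<sigma> a < \<sigma> b) \<and>
       (\<forall>a b. i \<le> a \<and> a < b \<and> b < n \<longrightarrow> \<sigma> a < \<sigma> b)}"

definition L_infty :: "(int \<Rightarrow> 'v::real_vector set) \<Rightarrow> (nat \<Rightarrow> 'v list \<Rightarrow> 'v) \<Rightarrow> bool" where
  "L_infty V L \<longleftrightarrow>
     graded_space V \<and>
     L 0 [] = 0 \<and>
     \<comment> \<open>multilinearity\<close>
     (\<forall>k xs j a b y z. length xs = k \<and> j < k \<longrightarrow>
        L k (xs[j := a *\<^sub>R y + b *\<^sub>R z]) = a *\<^sub>R L k (xs[j := y]) + b *\<^sub>R L k (xs[j := z])) \<and>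
     \<comment> \<open>degree 1\<close>
     (\<forall>k xs ds. length xs = k \<and> length ds = k \<and> (\<forall>j<k. xs ! j \<in> V (ds ! j)) \<longrightarrow>
        L k xs \<in> V (sum_list ds + 1)) \<and>
     \<comment> \<open>graded symmetry\<close>
     (\<forall>k xs j d e. length xs = k \<and> Suc j < k \<and> xs ! j \<in> V d \<and> xs ! Suc j \<in> V e \<longrightarrow>
        L k (xs[j := xs ! Suc j, Suc j := xs ! j]) = (if odd (d * e) then -1 else 1) *\<^sub>R L k xs) \<and>
     \<comment> \<open>L-infinity Jacobi identities\<close>
     (\<forall>n xs ds. 1 \<le> n \<and> length xs = n \<and> length ds = n \<and> (\<forall>j<n. xs ! j \<in> V (ds ! j)) \<longrightarrow>
        (\<Sum>i=1..n. \<Sum>\<sigma>\<in>unshuffles i n.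
           koszul_sign ds \<sigma> *\<^sub>R
             L (n - i + 1) (L i (map (\<lambda>a. xs ! \<sigma> a) [0..<i]) # map (\<lambda>a. xs ! \<sigma> a) [i..<n])) = 0)"

definition tw_partial :: "(nat \<Rightarrow> 'v list \<Rightarrow> 'v) \<Rightarrow> 'v \<Rightarrow> nat \<Rightarrow> 'v list \<Rightarrow> nat \<Rightarrow> 'v::real_normed_vector" where
  "tw_partial L u p vs n = (\<Sum>k<n. (1 / fact k) *\<^sub>R L (p + k) (replicate k u @ vs))"

definition conv_set :: "(int \<Rightarrow> 'v set) \<Rightarrow> (nat \<Rightarrow> 'v list \<Rightarrow> 'v) \<Rightarrow> 'v::real_normed_vector set" where
  "conv_set V L = {u \<in> V 0. \<forall>p vs. length vs = p \<longrightarrow>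
       (\<exists>s. limitin ftop (tw_partial L u p vs) s sequentially)}"

definition D_ell :: "(int \<Rightarrow> 'v set) \<Rightarrow> (nat \<Rightarrow> 'v list \<Rightarrow> 'v) \<Rightarrow> 'v::real_normed_vector set" where
  "D_ell V L = (subtopology ftop (V 0)) interior_of (conv_set V L)"

definition tw :: "(nat \<Rightarrow> 'v list \<Rightarrow> 'v) \<Rightarrow> 'v \<Rightarrow> nat \<Rightarrow> 'v list \<Rightarrow> 'v::real_normed_vector" where
  "tw L u p vs = (THE s. limitin ftop (tw_partial L u p vs) s sequentially)"

definition MC :: "(nat \<Rightarrow> 'v list \<Rightarrow> 'v) \<Rightarrow> 'v \<Rightarrow> 'v::real_normed_vector" where
  "MC L u = tw L u 0 []"

definition MC_element :: "(int \<Rightarrow> 'v set) \<Rightarrow> (nat \<Rightarrow> 'v list \<Rightarrow> 'v) \<Rightarrow> 'v::real_normed_vector \<Rightarrow> bool" where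
  "MC_element V L u \<longleftrightarrow> u \<in> D_ell V L \<and> MC L u = 0"

definition deriv_tower :: "real set \<Rightarrow> (nat \<Rightarrow> real \<Rightarrow> 'v::real_normed_vector) \<Rightarrow> bool" where
  "deriv_tower I f \<longleftrightarrow> (\<forall>n. \<forall>t\<in>I.
      limitin ftop (\<lambda>s. (1 / (s - t)) *\<^sub>R (f n s - f n t)) (f (Suc n) t) (at t within I))"

definition deformation ::
  "(int \<Rightarrow> 'v set) \<Rightarrow> (nat \<Rightarrow> 'v list \<Rightarrow> 'v) \<Rightarrow> 'v \<Rightarrow> real set \<Rightarrow> (nat \<Rightarrow> real \<Rightarrow> 'v::real_normed_vector) \<Rightarrow> bool" where
  "deformation V L u0 I f \<longleftrightarrow>
     is_interval I \<and> 0 \<in> I \<and> (\<exists>t\<in>I. t \<noteq> 0) \<and>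
     deriv_tower I f \<and>
     (\<forall>t\<in>I. f 0 t \<in> D_ell V L \<and> MC L (f 0 t) = 0) \<and>
     f 0 0 = u0"

definition Obs :: "(nat \<Rightarrow> 'v list \<Rightarrow> 'v) \<Rightarrow> (nat \<Rightarrow> real \<Rightarrow> 'v) \<Rightarrow> nat \<Rightarrow> 'v::real_normed_vector" where
  "Obs L f k = (\<Sum>i=2..k+1. \<Sum>rs\<in>{rs. length rs = i \<and> (\<forall>r\<in>set rs. 0 < r) \<and> sum_list rs = k + 1}.
      (fact (k + 1) / prod_list (map fact rs) * (1 / fact i)) *\<^sub>R
        tw L (f 0 0) i (map (\<lambda>r. f r 0) rs))"

end

theory Submission
  imports Defs "HOL-Computational_Algebra.Polynomial"
begin

text \<open>
  The witness is $-u_0^{k+1}$: differentiating $MC(u_t) = 0$ exactly $k+1$ times at $t = 0$ gives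
  $\ell_1^{u_0}(u_0^{k+1}) + Obs^k = 0$. Every linear functional is continuous for the finite topology
  and linear functionals separate points, so it suffices to prove this identity after applying an
  arbitrary functional; moreover $u_t$ stays in one finite-dimensional subspace for small $t$.

  What has to be justified is the Taylor expansion of $u \mapsto MC(u)$ at $u_0$, since the twisting
  series are only known to converge pointwise on $D_\ell$. Scaling $u$ by a factor greater than $1$
  turns pointwise convergence into pointwise geometric decay of the terms. The $k$-th term is a
  polynomial of degree at most $k$ on each line, and a weak form of the Remez inequality makes the
  decay uniform near $u_0$, at the price of an arbitrarily small loss in the rate.
\<close>

section \<open>From pointwise to uniform bounds for families of polynomials\<close>

text \<open>The pointwise decay comes with a constant that depends on the point in an uncontrolled
  way. A Baire argument would make it uniform only on some small open set; carrying that bound over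
  to \<open>u0\<close> could multiply the k-th term by the k-th power of a fixed number. This is
  fatal: \<open>D_ell\<close> is open but may be small, so the scaling factor may be close to 1, and
  so may the decay rate. Measure does better than category here, because the set where one constant
  works can be given almost full measure; interpolation from such a set costs a k-th power whose
  base is as close to 1 as desired, and the rate stays below 1.

  The path is smooth but need not be analytic. Both it and the twisting series are therefore
  replaced by Taylor polynomials of degree n = k + 1 with remainders of order n + 1, and
  coefficients of t^n are compared; this replaces an n-fold chain rule. Since 0 may be an endpoint
  of \<open>I\<close>, all limits and derivatives are taken within \<open>I\<close>.

  Linear functionals may be unbounded for the norm of the ambient space. Norm estimates are made
  only on finite-dimensional subspaces.\<close>

lemma lagrange_interpolation:
  fixes P :: "real poly" and y :: "nat \<Rightarrow> real"
  assumes inj: "inj_on y {..<N}" and deg: "degree P < N"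
  shows "poly P x = (\<Sum>i<N. poly P (y i) * (\<Prod>j\<in>{..<N}-{i}. (x - y j) / (y i - y j)))"
proof -
  define Q where "Q = (\<Sum>i<N. smult (poly P (y i)) (\<Prod>j\<in>{..<N}-{i}. smult (1 / (y i - y j)) [:- y j, 1:]))"
  have Q: "poly Q z = (\<Sum>i<N. poly P (y i) * (\<Prod>j\<in>{..<N}-{i}. (z - y j) / (y i - y j)))" for z
    by (simp add: Q_def poly_sum poly_prod diff_divide_distrib)
  have "degree (\<Prod>j\<in>{..<N}-{i}. smult (1 / (y i - y j)) [:- y j, 1:]) < N" if "i < N" for i
  proof -
    have "degree (\<Prod>j\<in>{..<N}-{i}. smult (1 / (y i - y j)) [:- y j, 1:])
        \<le> (\<Sum>j\<in>{..<N}-{i}. degree (smult (1 / (y i - y j)) [:- y j, 1:]))"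
      using degree_prod_sum_le[of "{..<N}-{i}" "\<lambda>j. smult (1 / (y i - y j)) [:- y j, 1:]"]
      by (simp add: o_def)
    also have "\<dots> \<le> (\<Sum>j\<in>{..<N}-{i}. 1)"
      by (intro sum_mono) (auto simp: degree_smult_eq)
    also have "\<dots> < N" using that by simp
    finally show ?thesis .
  qed
  then have degQ: "degree Q < N"
    unfolding Q_def using deg
    by (intro degree_sum_less) (auto intro: le_less_trans[OF degree_smult_le])
  have "poly Q (y k) = poly P (y k)" if k: "k < N" for k
  proof -
    have "(\<Prod>j\<in>{..<N}-{i}. (y k - y j) / (y i - y j)) = (if i = k then 1 else 0)" if i: "i < N" for i
    proof (cases "i = k")
      case True
      have "y k \<noteq> y j" if "j \<in> {..<N} - {k}" for j
        using inj_onD[OF inj, of k j] k that by auto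
      with True show ?thesis by (auto intro!: prod.neutral)
    next
      case False
      then show ?thesis using k by (auto intro!: prod_zero bexI[of _ k])
    qed
    then have "poly Q (y k) = (\<Sum>i<N. poly P (y i) * (if i = k then 1 else 0))"
      unfolding Q by (intro sum.cong) auto
    then show ?thesis using k by (simp add: if_distrib cong: if_cong)
  qed
  then have "Q = P"
    using inj degQ deg
    by (intro poly_eqI_degree[of "y ` {..<N}"]) (auto simp: card_image)
  then show ?thesis using Q by metis
qed

text \<open>Picking the next point of $E$ at distance at least $h$ yields almost equispaced nodes: the
  part of the interval missing from $E$ delays each of them by at most $\delta$ in total.\<close>

lemma greedy_nodes:
  fixes E :: "real set" and a l h \<delta> :: real
  assumes E: "closed E" "E \<subseteq> {a..a+l}" and h: "0 < h"
    and meas: "measure lborel E \<ge> l - \<delta>" and N: "real N * h < l - \<delta>"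
  shows "\<exists>y::nat \<Rightarrow> real. \<forall>j\<le>N. y j \<in> E \<and> a + j * h \<le> y j \<and> y j \<le> a + j * h + \<delta> \<and>
           (\<forall>i\<le>j. y i + (real j - real i) * h \<le> y j)"
proof -
  \<comment> \<open>\<open>m\<close> measures the part of \<open>E\<close> already passed. A greedy
    jump passes at most h of it: the stretch between x + h and the next point of \<open>E\<close>
    contains nothing of \<open>E\<close>.\<close>
  define m where "m x = measure lborel (E \<inter> {..<x})" for x
  have Eb[measurable]: "E \<in> sets borel" using E(1) by auto
  have fin: "emeasure lborel (E \<inter> X) < \<infinity>" for X :: "real set"
  proof -
    have "emeasure lborel (E \<inter> X) \<le> emeasure lborel {a..a+l}"
      using E by (intro emeasure_mono) auto
    also have "\<dots> < \<infinity>" by (simp add: emeasure_lborel_Icc_eq)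
    finally show ?thesis .
  qed
  have fmE: "E \<inter> X \<in> fmeasurable lborel" if "X \<in> sets borel" for X
    using fin[of X] that by (intro fmeasurableI) auto
  have m_step: "m z \<le> m x + h" if "z \<le> x + h \<or> E \<inter> {x+h..<z} = {}" for x z
  proof -
    have sub: "E \<inter> {..<z} \<subseteq> (E \<inter> {..<x}) \<union> {x..x+h}"
      using that by force
    have fm: "(E \<inter> {..<x}) \<in> fmeasurable lborel" "{x..x+h} \<in> fmeasurable lborel"
      using fmE[of "{..<x}"] by (auto simp: fmeasurable_def emeasure_lborel_Icc_eq)
    have "m z \<le> measure lborel ((E \<inter> {..<x}) \<union> {x..x+h})"
      unfolding m_def using sub fm fmE[of "{..<z}"]
      by (intro measure_mono_fmeasurable) auto
    also have "\<dots> \<le> measure lborel (E \<inter> {..<x}) + measure lborel {x..x+h}"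
      using fm by (intro measure_Un_le) auto
    finally show ?thesis using h by (simp add: m_def)
  qed
  have m_top: "m z \<ge> l - \<delta>" if "E \<inter> {z..} = {}" for z
  proof -
    have "E \<inter> {..<z} = E" using that by force
    then show ?thesis using meas by (simp add: m_def)
  qed
  \<comment> \<open>At most \<delta> of the interval is missing from \<open>E\<close>, so a position
    is at most \<delta> ahead of the mass to its left. With m (y j) \<le> j h this is the bound on
    the delay.\<close>
  have up: "z \<le> a + m z + \<delta>" if "z \<in> {a..a+l}" for z
  proof -
    have fm: "(E \<inter> {..<z}) \<in> fmeasurable lborel" "{z..a+l} \<in> fmeasurable lborel"
      using fmE[of "{..<z}"] by (auto simp: fmeasurable_def emeasure_lborel_Icc_eq)
    have "l - \<delta> \<le> measure lborel E" by (rule meas)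
    also have "\<dots> \<le> measure lborel ((E \<inter> {..<z}) \<union> {z..a+l})"
      using E fm fmE[of UNIV] by (intro measure_mono_fmeasurable) auto
    also have "\<dots> \<le> measure lborel (E \<inter> {..<z}) + measure lborel {z..a+l}"
      using fm by (intro measure_Un_le) auto
    finally show ?thesis using that by (simp add: m_def)
  qed
  have bb: "bdd_below (E \<inter> {z..})" for z by (meson bdd_below_Ici bdd_below_mono inf_le2)
  have Inf_in: "Inf (E \<inter> {z..}) \<in> E \<inter> {z..}" if "E \<inter> {z..} \<noteq> {}" for z
    using E(1) that bb by (intro closed_contains_Inf) auto
  have Inf_gap: "E \<inter> {z..<Inf (E \<inter> {z..})} = {}" for z
    using cInf_lower[OF _ bb, of _ z] by fastforce
  define y where "y = rec_nat (Inf (E \<inter> {a..})) (\<lambda>_ x. Inf (E \<inter> {x + h..}))"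
  have y0: "y 0 = Inf (E \<inter> {a..})" and yS: "y (Suc j) = Inf (E \<inter> {y j + h..})" for j
    by (simp_all add: y_def)
  have inv: "y j \<in> E \<and> a + j * h \<le> y j \<and> m (y j) \<le> j * h \<and> (\<forall>i\<le>j. y i + (real j - real i) * h \<le> y j)"
    if "j \<le> N" for j
    using that
  proof (induction j)
    case 0
    have "0 \<le> real N * h" using h by simp
    then have "l - \<delta> > 0" using N by linarith
    moreover have "E = {} \<Longrightarrow> measure lborel E = 0" by simp
    ultimately have ne: "E \<noteq> {}" using meas by force
    have "E \<inter> {a..} \<noteq> {}" using ne E by force
    moreover have "E \<inter> {..<y 0} = {}"
      using Inf_gap[of a] E unfolding y0 by (force simp: not_less)
    ultimately show ?case using Inf_in[of a] by (auto simp: y0 m_def)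
  next
    case (Suc j)
    then have IH: "y j \<in> E" "a + j * h \<le> y j" "m (y j) \<le> j * h" "\<forall>i\<le>j. y i + (real j - real i) * h \<le> y j" by auto
    have "real (Suc j) * h \<le> real N * h" using Suc.prems h by (intro mult_right_mono) auto
    then have lt: "real j * h + h < l - \<delta>" using N by (simp add: algebra_simps)
    \<comment> \<open>The mass passed so far is at most (j + 1) h, which is less than the mass of
      \<open>E\<close>. Hence points of \<open>E\<close> remain and the greedy choice does not run
      out.\<close>
    have "m (y j + h) \<le> m (y j) + h" by (rule m_step) simp
    then have "E \<inter> {y j + h..} \<noteq> {}" using m_top[of "y j + h"] IH lt by force
    then have in': "y (Suc j) \<in> E \<inter> {y j + h..}" unfolding yS by (rule Inf_in)
    have "m (y (Suc j)) \<le> m (y j) + h"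
      using Inf_gap[of "y j + h"] by (intro m_step) (simp add: yS)
    moreover have "y i + (real (Suc j) - real i) * h \<le> y (Suc j)" if "i \<le> Suc j" for i
    proof (cases "i = Suc j")
      case False
      then have "y i + (real j - real i) * h \<le> y j" using that IH(4) by simp
      then show ?thesis using in' by (simp add: algebra_simps)
    qed simp
    moreover have "a + real (Suc j) * h \<le> y (Suc j)" using in' IH(2) by (simp add: algebra_simps)
    moreover have "m (y j) + h \<le> real (Suc j) * h" using IH(3) by (simp add: algebra_simps)
    ultimately show ?case using in' by fastforce
  qed
  have "y j \<le> a + j * h + \<delta>" if "j \<le> N" for j
    using inv[OF that] up[of "y j"] E by force
  with inv show ?thesis by (intro exI[of _ y]) blast
qed

text \<open>These are the denominators of the Lagrange basis at nodes of unit spacing: the nodes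
  left of i contribute i!, those right of i contribute (N - 1 - i)!.\<close>

lemma prod_abs_diff_nodes:
  assumes "i < (N::nat)"
  shows "(\<Prod>j\<in>{..<N}-{i}. \<bar>real i - real j\<bar>) = fact i * fact (N - 1 - i)"
proof -
  have "{..<N}-{i} = {..<i} \<union> {Suc i..<N}" using assms by auto
  moreover have "(\<Prod>j\<in>{..<i} \<union> {Suc i..<N}. \<bar>real i - real j\<bar>) =
      (\<Prod>j<i. \<bar>real i - real j\<bar>) * (\<Prod>j\<in>{Suc i..<N}. \<bar>real i - real j\<bar>)"
    by (rule prod.union_disjoint) auto
  ultimately have "(\<Prod>j\<in>{..<N}-{i}. \<bar>real i - real j\<bar>) =
      (\<Prod>j<i. \<bar>real i - real j\<bar>) * (\<Prod>j\<in>{Suc i..<N}. \<bar>real i - real j\<bar>)"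
    by metis
  also have "(\<Prod>j<i. \<bar>real i - real j\<bar>) = (\<Prod>j\<in>{1..i}. real j)"
    by (rule prod.reindex_bij_witness[of _ "\<lambda>j. i - j" "\<lambda>j. i - j"]) auto
  also have "(\<Prod>j\<in>{Suc i..<N}. \<bar>real i - real j\<bar>) = (\<Prod>j\<in>{1..N-1-i}. real j)"
    by (rule prod.reindex_bij_witness[of _ "\<lambda>j. j + i" "\<lambda>j. j - i"]) auto
  finally show ?thesis by (simp add: fact_prod)
qed

text \<open>The matching numerators, in units of the spacing: the evaluation point lies at node n up
  to an error of d + 1 spacings. The left half of the nodes gives (n + d + 1)! / (d + 1)! exactly,
  and the right half is termwise smaller.\<close>

lemma prod_shifted_nodes:
  "(\<Prod>j<2*n. \<bar>real j - real n\<bar> + real (Suc d)) \<le> (real ((n + Suc d) choose Suc d) * fact n)\<^sup>2"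
proof -
  let ?D = "Suc d"
  let ?X = "\<Prod>a\<in>{1..n}. real a + real ?D"
  have split: "{..<2*n} = {..<n} \<union> {n..<2*n}" by auto
  have "(\<Prod>j<2*n. \<bar>real j - real n\<bar> + real ?D) =
      (\<Prod>j<n. \<bar>real j - real n\<bar> + real ?D) * (\<Prod>j\<in>{n..<2*n}. \<bar>real j - real n\<bar> + real ?D)"
    unfolding split by (subst prod.union_disjoint) auto
  also have "(\<Prod>j<n. \<bar>real j - real n\<bar> + real ?D) = ?X"
    by (rule prod.reindex_bij_witness[of _ "\<lambda>j. n - j" "\<lambda>j. n - j"]) auto
  also have "(\<Prod>j\<in>{n..<2*n}. \<bar>real j - real n\<bar> + real ?D) = (\<Prod>a\<in>{1..n}. real a - 1 + real ?D)"
    by (rule prod.reindex_bij_witness[of _ "\<lambda>j. j + n - 1" "\<lambda>j. j + 1 - n"]) auto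
  also have "?X * (\<Prod>a\<in>{1..n}. real a - 1 + real ?D) \<le> ?X * ?X"
    by (intro mult_left_mono prod_mono prod_nonneg) auto
  also have "?X = real ((n + ?D) choose ?D) * fact n"
  proof -
    have "fact (n + ?D) = fact ?D * ?X"
      by (induction n) (simp_all add: algebra_simps)
    moreover have "fact (n + ?D) = fact ?D * fact n * real ((n + ?D) choose ?D)"
      using arg_cong[OF binomial_fact_lemma[of ?D "n + ?D"], of real]
      by (simp add: mult_ac del: fact_Suc)
    ultimately have "fact ?D * ?X = fact ?D * (real ((n + ?D) choose ?D) * fact n)"
      by (simp only: mult.assoc mult.commute[of "real ((n + ?D) choose ?D)"])
    then show ?thesis by (subst (asm) mult_cancel_left) (simp del: fact_Suc)
  qed
  finally show ?thesis by (simp only: power2_eq_square)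
qed

text \<open>With x in the middle of the 2n nodes, each Lagrange basis polynomial has numerator at
  most (c n!)^2, where c is the binomial coefficient, and denominator at least n! (n - 1)!. Their
  quotient is n c^2. Evaluation near the ends of the nodes would instead cost a factor like
  4^n.\<close>

lemma poly_bound_of_nodes:
  fixes P :: "real poly" and y :: "nat \<Rightarrow> real"
  assumes n: "0 < n" and h: "0 < h" and deg: "degree P < 2 * n"
    and near: "\<And>j. j < 2 * n \<Longrightarrow> \<bar>y j - x\<bar> \<le> (\<bar>real j - real n\<bar> + real (Suc d)) * h"
    and sep: "\<And>i j. i \<le> j \<Longrightarrow> j < 2 * n \<Longrightarrow> y i + (real j - real i) * h \<le> y j"
    and M: "\<And>j. j < 2 * n \<Longrightarrow> \<bar>poly P (y j)\<bar> \<le> M"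
  shows "\<bar>poly P x\<bar> \<le> M * (2 * (real n)\<^sup>2 * (real ((n + Suc d) choose Suc d))\<^sup>2)"
proof -
  let ?N = "2 * n" and ?c = "real ((n + Suc d) choose Suc d)"
  have sep': "\<bar>real i - real j\<bar> * h \<le> \<bar>y i - y j\<bar>" if "i < ?N" "j < ?N" for i j
    using sep[of i j] sep[of j i] that h
    by (cases "i \<le> j") (auto simp: algebra_simps abs_if)
  have inj: "inj_on y {..<?N}"
  proof (rule inj_onI)
    fix i j assume ij: "i \<in> {..<?N}" "j \<in> {..<?N}" "y i = y j"
    then have "\<bar>real i - real j\<bar> * h \<le> 0" using sep'[of i j] by simp
    then show "i = j" using h by (simp add: mult_le_0_iff)
  qed
  have M0: "0 \<le> M" using M[of 0] n by force
  have fac: "\<bar>\<Prod>j\<in>{..<?N}-{i}. (x - y j) / (y i - y j)\<bar> \<le> real n * ?c\<^sup>2" if i: "i < ?N" for i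
  proof -
    let ?J = "{..<?N}-{i}"
    have "\<bar>\<Prod>j\<in>?J. (x - y j) / (y i - y j)\<bar> = (\<Prod>j\<in>?J. \<bar>x - y j\<bar> / \<bar>y i - y j\<bar>)"
      by (simp add: abs_prod)
    also have "\<dots> \<le> (\<Prod>j\<in>?J. (\<bar>real j - real n\<bar> + real (Suc d)) / \<bar>real i - real j\<bar>)"
    proof (rule prod_mono)
      fix j assume j: "j \<in> ?J"
      have "\<bar>x - y j\<bar> / \<bar>y i - y j\<bar> \<le> ((\<bar>real j - real n\<bar> + real (Suc d)) * h) / (\<bar>real i - real j\<bar> * h)"
        using near[of j] sep'[of i j] i j h by (intro frac_le) (auto simp: abs_minus_commute)
      then show "0 \<le> \<bar>x - y j\<bar> / \<bar>y i - y j\<bar> \<and> \<bar>x - y j\<bar> / \<bar>y i - y j\<bar>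
          \<le> (\<bar>real j - real n\<bar> + real (Suc d)) / \<bar>real i - real j\<bar>"
        using h by simp
    qed
    also have "\<dots> = (\<Prod>j\<in>?J. \<bar>real j - real n\<bar> + real (Suc d)) / (fact i * fact (?N - 1 - i))"
      using prod_abs_diff_nodes[OF i] by (simp add: prod_dividef)
    also have "\<dots> \<le> (?c * fact n)\<^sup>2 / (fact i * fact (?N - 1 - i))"
    proof (rule divide_right_mono)
      have "(\<Prod>j\<in>?J. \<bar>real j - real n\<bar> + real (Suc d)) \<le> (\<Prod>j<?N. \<bar>real j - real n\<bar> + real (Suc d))"
        by (intro prod_mono2) auto
      then show "(\<Prod>j\<in>?J. \<bar>real j - real n\<bar> + real (Suc d)) \<le> (?c * fact n)\<^sup>2"
        using prod_shifted_nodes[of n d] by linarith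
    qed simp
    also have "\<dots> \<le> real n * ?c\<^sup>2"
    proof -
      \<comment> \<open>Both sides are (2n - 1)!. The product of the two factorials is thus smallest
        where the binomial coefficient is largest, at the centre.\<close>
      have bin: "fact i * fact (?N - 1 - i) * real ((?N - 1) choose i) = (fact n * fact (n - 1) * real ((?N - 1) choose (n - 1)) :: real)"
        using arg_cong[OF binomial_fact_lemma[of i "?N - 1"], of real]
          arg_cong[OF binomial_fact_lemma[of "n - 1" "?N - 1"], of real] i n
        by (simp add: mult_ac)
      have "(?N - 1) choose i \<le> (?N - 1) choose (n - 1)"
        using binomial_maximum[of "?N - 1" i] n by (cases n) auto
      moreover have "0 < (?N - 1) choose (n - 1)" using n by simp
      ultimately have le: "real ((?N - 1) choose i) \<le> real ((?N - 1) choose (n - 1))" "0 < real ((?N - 1) choose (n - 1))"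
        by simp_all
      have "fact n * fact (n - 1) * real ((?N - 1) choose (n - 1))
          \<le> fact i * fact (?N - 1 - i) * real ((?N - 1) choose (n - 1))"
        unfolding bin[symmetric] by (intro mult_left_mono le) simp
      then have "(fact n * fact (n - 1) :: real) \<le> fact i * fact (?N - 1 - i)"
        using le(2) by (simp only: mult_le_cancel_right_pos)
      then have "(fact n)\<^sup>2 \<le> real n * (fact i * fact (?N - 1 - i))"
        using n by (simp add: power2_eq_square fact_reduce[of n] mult_left_mono mult.assoc mult.left_commute)
      then have "?c\<^sup>2 * (fact n)\<^sup>2 \<le> ?c\<^sup>2 * (real n * (fact i * fact (?N - 1 - i)))"
        by (rule mult_left_mono) simp
      moreover have "0 < (fact i * fact (?N - 1 - i) :: real)" by simp
      ultimately show ?thesis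
        by (simp only: power_mult_distrib pos_divide_le_eq mult.assoc mult.left_commute)
    qed
    finally show ?thesis .
  qed
  have "\<bar>poly P x\<bar> \<le> (\<Sum>i<?N. \<bar>poly P (y i) * (\<Prod>j\<in>{..<?N}-{i}. (x - y j) / (y i - y j))\<bar>)"
    unfolding lagrange_interpolation[OF inj deg, of x] by (rule sum_abs)
  also have "\<dots> \<le> (\<Sum>i<?N. M * (real n * ?c\<^sup>2))"
    unfolding abs_mult using M M0 fac by (intro sum_mono mult_mono) auto
  finally show ?thesis by (simp add: power2_eq_square algebra_simps)
qed

text \<open>A single term of the binomial expansion of ((\<mu> - 1) + 1)^(n + D) bounds the
  coefficient by \<mu>^n (\<mu> / (\<mu> - 1))^D. The base of the second power may be large, but D
  is only about n / g, and g is chosen to make up for it.\<close>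

lemma binomial_le_power:
  fixes \<mu> :: real
  assumes "1 < \<mu>" and g: "\<mu> / (\<mu> - 1) \<le> \<mu> ^ g" and D: "g * D \<le> n + g"
  shows "real ((n + D) choose D) \<le> \<mu> ^ (2 * n + g)"
proof -
  let ?X = "\<mu> - 1"
  have "real ((n + D) choose D) * ?X ^ D \<le> (\<Sum>k\<le>n + D. real ((n + D) choose k) * ?X ^ k)"
    using assms(1) by (intro member_le_sum) auto
  also have "\<dots> = \<mu> ^ (n + D)"
    using binomial_ring[of ?X 1 "n + D"] by simp
  finally have "real ((n + D) choose D) \<le> \<mu> ^ n * (\<mu> / ?X) ^ D"
    using assms(1) by (simp add: field_simps power_add)
  also have "\<dots> \<le> \<mu> ^ n * (\<mu> ^ g) ^ D"
    using assms by (intro mult_left_mono power_mono) auto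
  also have "\<dots> = \<mu> ^ (n + g * D)" by (simp add: power_add power_mult)
  also have "\<dots> \<le> \<mu> ^ (2 * n + g)"
    using assms D by (intro power_increasing) auto
  finally show ?thesis .
qed

text \<open>The set where the family is bounded by $m q^k$ has almost full measure in the interval when $m$
  is large. Lagrange interpolation at almost equispaced nodes in that set, with the evaluation
  point in the middle of the nodes, costs only a factor $\mu^{O(k)}$ with $\mu$ arbitrarily close
  to $1$.\<close>

lemma polynomial_family_bound:
  fixes f :: "'i \<Rightarrow> nat \<Rightarrow> real \<Rightarrow> real"
  assumes R: "0 < R" and q: "0 < q" "q < q'"
    and poly: "\<And>i k. i \<in> I \<Longrightarrow> \<exists>P. degree P \<le> k \<and> (\<forall>x. poly P x = f i k x)"
    and bd: "\<And>x. \<bar>x\<bar> \<le> R \<Longrightarrow> \<exists>C. \<forall>i\<in>I. \<forall>k. \<bar>f i k x\<bar> \<le> C * q ^ k"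
  shows "\<exists>C. \<forall>x i k. \<bar>x\<bar> \<le> R / 2 \<longrightarrow> i \<in> I \<longrightarrow> \<bar>f i k x\<bar> \<le> C * q' ^ k"
proof -
  \<comment> \<open>The loss is six powers of \<mu> for each k: two absorb the factor n^2 through
    \<open>lin\<close>, four come from the squared binomial coefficient.\<close>
  define \<mu> where "\<mu> = root 6 (q' / q)"
  have \<mu>: "1 < \<mu>" and \<mu>6: "q * \<mu> ^ 6 = q'"
    using q by (auto simp: \<mu>_def)
  obtain g0 where "\<mu> / (\<mu> - 1) < \<mu> ^ g0" using real_arch_pow[OF \<mu>] by blast
  moreover have "1 < \<mu> / (\<mu> - 1)" using \<mu> by simp
  ultimately obtain g where g: "\<mu> / (\<mu> - 1) \<le> \<mu> ^ g" "0 < g"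
    by (metis less_eq_real_def not_gr_zero not_less power_0)
  define r where "r = R / 2"
  \<comment> \<open>Chosen so that r - \<delta> = g \<delta>. The admissible delay of the nodes is
    then a g-th part of the length r - \<delta> covered by n spacings.\<close>
  define \<delta> where "\<delta> = r / (real g + 1)"
  have r: "0 < r" and \<delta>: "0 < \<delta>" using R by (auto simp: r_def \<delta>_def add_pos_pos)
  define F where "F m = {x. \<bar>x\<bar> \<le> R \<and> (\<forall>i\<in>I. \<forall>k. \<bar>f i k x\<bar> \<le> real m * q ^ k)}" for m
  have cont: "continuous_on UNIV (f i k)" if i: "i \<in> I" for i k
  proof -
    obtain P where "\<forall>x. poly P x = f i k x" using poly[OF i] by blast
    then have "f i k = poly P" by auto
    then show ?thesis by (auto intro: continuous_intros)
  qed
  have closedF: "closed (F m)" for m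
  proof -
    have "F m = {x. \<bar>x\<bar> \<le> R} \<inter> (\<Inter>i\<in>I. \<Inter>k. {x. \<bar>f i k x\<bar> \<le> real m * q ^ k})"
      by (auto simp: F_def)
    then show ?thesis
      by (auto intro!: closed_Int closed_INT closed_Collect_le continuous_intros cont)
  qed
  have mono: "incseq F"
  proof (rule incseq_SucI)
    fix m
    have "real m * q ^ k \<le> real (Suc m) * q ^ k" for k using q(1) by (intro mult_right_mono) auto
    then show "F m \<subseteq> F (Suc m)" unfolding F_def by (blast intro: order_trans)
  qed
  have FUN: "(\<Union>m. F m) = {-R..R}"
  proof (intro equalityI subsetI)
    fix x assume "x \<in> {-R..R}"
    then have x: "\<bar>x\<bar> \<le> R" by auto
    then obtain C where C: "\<forall>i\<in>I. \<forall>k. \<bar>f i k x\<bar> \<le> C * q ^ k" using bd by blast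
    obtain m :: nat where "C \<le> m" using real_arch_simple by blast
    then have "C * q ^ k \<le> real m * q ^ k" for k using q(1) by (intro mult_right_mono) auto
    then have "x \<in> F m" using C x unfolding F_def by (blast intro: order_trans)
    then show "x \<in> (\<Union>m. F m)" by blast
  qed (auto simp: F_def)
  have "(\<lambda>m. measure lborel (F m)) \<longlonglongrightarrow> measure lborel (\<Union>m. F m)"
    using closedF mono FUN by (intro Lim_measure_incseq) (auto simp: emeasure_lborel_Icc_eq)
  then have "(\<lambda>m. measure lborel (F m)) \<longlonglongrightarrow> 2 * R" using R by (simp add: FUN)
  then have "\<forall>\<^sub>F m in sequentially. 2 * R - \<delta> < measure lborel (F m)"
    using \<delta> by (intro order_tendstoD) auto
  then obtain m where m: "2 * R - \<delta> < measure lborel (F m)"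
    by (auto simp: eventually_sequentially)
  \<comment> \<open>Bernoulli's inequality: a linear factor is absorbed by \<mu>^k at the price of a
    constant.\<close>
  have lin: "real (Suc k) \<le> max 1 (1 / (\<mu> - 1)) * \<mu> ^ k" for k
  proof -
    let ?K = "max 1 (1 / (\<mu> - 1))"
    have "1 + real k * (\<mu> - 1) \<le> \<mu> ^ k" using Bernoulli_inequality[of "\<mu> - 1" k] \<mu> by simp
    then have "?K * (1 + real k * (\<mu> - 1)) \<le> ?K * \<mu> ^ k" by (intro mult_left_mono) auto
    moreover have "1 \<le> ?K" "1 \<le> ?K * (\<mu> - 1)"
      using \<mu> by (auto simp: max_def field_simps)
    moreover have "real k * 1 \<le> real k * (?K * (\<mu> - 1))" using calculation by (intro mult_left_mono) auto
    ultimately show ?thesis by (simp add: algebra_simps)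
  qed
  let ?K = "max 1 (1 / (\<mu> - 1))"
  have "\<bar>f i k x\<bar> \<le> (2 * real m * ?K\<^sup>2 * \<mu> ^ (4 + 2 * g)) * q' ^ k"
    if x: "\<bar>x\<bar> \<le> r" and i: "i \<in> I" for x i k
  proof -
    obtain P where P: "degree P \<le> k" "\<And>z. poly P z = f i k z" using poly[OF i, of k] by blast
    define n where "n = Suc k"
    define h where "h = (r - \<delta>) / n"
    have r\<delta>: "r - \<delta> = real g * \<delta>" by (simp add: \<delta>_def field_simps)
    have h: "0 < h" using r\<delta> g \<delta> by (simp add: h_def n_def)
    have nh: "real n * h = r - \<delta>" by (simp add: h_def n_def)
    \<comment> \<open>Since n h = g \<delta>, the delay \<delta> amounts to n / g spacings, hence to
      at most d + 1. Conversely g (d + 1) \<le> n + g, as \<open>binomial_le_power\<close>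
      requires.\<close>
    define d where "d = n div g"
    have \<delta>d: "\<delta> \<le> real (Suc d) * h"
    proof -
      have "n \<le> g * Suc d" using g unfolding d_def
        by (metis add.commute div_mult_mod_eq less_imp_le mod_less_divisor mult.commute mult_Suc_right nat_add_left_cancel_le)
      then have "real n * h \<le> real (g * Suc d) * h" using h by (intro mult_right_mono) (auto simp only: of_nat_le_iff)
      then have "real g * \<delta> \<le> real g * (real (Suc d) * h)" using nh r\<delta> by (simp only: of_nat_mult mult.assoc)
      then show ?thesis using g(2) by (simp only: mult_le_cancel_left_pos of_nat_0_less_iff)
    qed
    \<comment> \<open>The window of radius r = R / 2 around x stays inside [-R, R], so the part of
      it missing from \<open>F m\<close> still has measure less than \<delta>.\<close>
    define E where "E = F m \<inter> {x - r..x + r}"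
    have cE: "closed E" by (simp add: E_def closedF closed_Int)
    have fm: "E \<in> fmeasurable lborel" "F m \<in> fmeasurable lborel"
    proof -
      show "F m \<in> fmeasurable lborel"
        by (rule fmeasurableI2[of "{-R..R}"]) (use closedF in \<open>auto simp: F_def fmeasurable_def emeasure_lborel_Icc_eq\<close>)
      then show "E \<in> fmeasurable lborel"
        by (rule fmeasurableI2) (use cE in \<open>auto simp: E_def\<close>)
    qed
    have "measure lborel (F m) \<le> measure lborel (E \<union> ({-R..x - r} \<union> {x + r..R}))"
    proof (rule measure_mono_fmeasurable)
      show "F m \<subseteq> E \<union> ({-R..x - r} \<union> {x + r..R})" by (auto simp: F_def E_def)
      have "{a..b} \<in> fmeasurable lborel" for a b :: real
        by (simp add: fmeasurable_def emeasure_lborel_Icc_eq)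
      then show "E \<union> ({-R..x - r} \<union> {x + r..R}) \<in> fmeasurable lborel"
        using fm(1) by (intro fmeasurable.Un)
    qed (use closedF in auto)
    also have "\<dots> \<le> measure lborel E + measure lborel ({-R..x - r} \<union> {x + r..R})"
      using fm by (intro measure_Un_le) auto
    also have "measure lborel ({-R..x - r} \<union> {x + r..R}) \<le> measure lborel {-R..x - r} + measure lborel {x + r..R}"
      by (intro measure_Un_le) auto
    also have "\<dots> = 2 * R - 2 * r"
      using abs_le_D1[OF x] abs_le_D2[OF x] R by (simp add: r_def)
    finally have mE: "2 * r - \<delta> \<le> measure lborel E" using m by simp
    have "real (2 * n - 1) * h < 2 * r - \<delta>"
    proof -
      have "real (2 * n - 1) * h = 2 * (r - \<delta>) - h"
        using nh by (simp add: n_def of_nat_diff algebra_simps)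
      then show ?thesis using h \<delta> by simp
    qed
    moreover have "E \<subseteq> {x - r..(x - r) + 2 * r}" by (auto simp: E_def)
    ultimately obtain y where y: "\<And>j. j \<le> 2 * n - 1 \<Longrightarrow> y j \<in> E \<and> (x - r) + j * h \<le> y j \<and>
        y j \<le> (x - r) + j * h + \<delta> \<and> (\<forall>i\<le>j. y i + (real j - real i) * h \<le> y j)"
      using greedy_nodes[OF cE _ h mE, of "x - r" "2 * n - 1"] by blast
    have "\<bar>poly P x\<bar> \<le> (real m * q ^ k) * (2 * (real n)\<^sup>2 * (real ((n + Suc d) choose Suc d))\<^sup>2)"
    proof (rule poly_bound_of_nodes[where y = y and h = h])
      show "0 < n" "degree P < 2 * n" using P(1) by (auto simp: n_def)
      \<comment> \<open>As r = n h + \<delta>, node j lies between x + (j - n) h - \<delta> and x +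
        (j - n) h. Node n is thus the one next to x.\<close>
      show "\<bar>y j - x\<bar> \<le> (\<bar>real j - real n\<bar> + real (Suc d)) * h" if "j < 2 * n" for j
      proof -
        have "(real j - real n) * h \<le> \<bar>real j - real n\<bar> * h" "-((real j - real n) * h) \<le> \<bar>real j - real n\<bar> * h"
          using h by (simp_all add: mult_right_mono flip: mult_minus_left)
        moreover have "r = real n * h + \<delta>" using nh by simp
        moreover have "(x - r) + j * h \<le> y j" "y j \<le> (x - r) + j * h + \<delta>" using y[of j] that by auto
        ultimately show ?thesis using \<delta>d \<delta> unfolding abs_le_iff left_diff_distrib distrib_right
          by (simp only:) linarith
      qed
      show "\<bar>poly P (y j)\<bar> \<le> real m * q ^ k" if "j < 2 * n" for j
        using y[of j] that i P(2) by (auto simp: E_def F_def)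
    qed (use y h in auto)
    also have "\<dots> \<le> (real m * q ^ k) * (2 * (?K * \<mu> ^ k)\<^sup>2 * (\<mu> ^ (2 * n + g))\<^sup>2)"
    proof -
      have "real ((n + Suc d) choose Suc d) \<le> \<mu> ^ (2 * n + g)"
        using binomial_le_power[OF \<mu> g(1), of "Suc d" n] by (simp add: d_def)
      then show ?thesis using lin[of k] q(1) \<mu> unfolding n_def
        by (intro mult_left_mono mult_mono power_mono) auto
    qed
    also have "\<dots> = (2 * real m * ?K\<^sup>2 * \<mu> ^ (4 + 2 * g)) * (q * \<mu> ^ 6) ^ k"
    proof -
      have "(\<mu> ^ (2 * n + g))\<^sup>2 = \<mu> ^ (4 + 2 * g) * \<mu> ^ (4 * k)"
      proof -
        have "(2 * n + g) * 2 = (4 + 2 * g) + 4 * k" by (simp add: n_def)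
        then show ?thesis by (simp only: flip: power_mult power_add)
      qed
      moreover have "(\<mu> ^ k)\<^sup>2 = \<mu> ^ (2 * k)" by (simp add: power_mult[symmetric] mult.commute)
      moreover have "(\<mu> ^ 6) ^ k = \<mu> ^ (2 * k) * \<mu> ^ (4 * k)" by (simp add: power_add[symmetric] power_mult[symmetric])
      ultimately show ?thesis by (simp only: power_mult_distrib mult_ac)
    qed
    finally show ?thesis using \<mu>6 P(2) by simp
  qed
  then show ?thesis unfolding r_def by blast
qed

section \<open>The finite topology\<close>

text \<open>Coordinates are read off in a basis of the whole space that extends \<open>B\<close>.
  This makes them linear functionals defined everywhere, as the continuity and separation arguments
  need.\<close>

lemma dual_coordinates:
  fixes B :: "'v::real_vector set"
  assumes B: "independent B" "finite B"
  obtains \<psi> :: "'v \<Rightarrow> 'v \<Rightarrow> real"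
  where "\<And>c. linear (\<psi> c)" "\<And>v. v \<in> span B \<Longrightarrow> v = (\<Sum>c\<in>B. \<psi> c v *\<^sub>R c)"
proof
  let ?E = "extend_basis B"
  have E: "independent ?E" "span ?E = UNIV" "B \<subseteq> ?E"
    using independent_extend_basis[OF B(1)] span_extend_basis[OF B(1)] extend_basis_superset[OF B(1)] by auto
  show "linear (\<lambda>v. representation ?E v c)" for c
    using E by (intro linearI) (auto simp: representation_add representation_scale)
  show "v = (\<Sum>c\<in>B. representation ?E v c *\<^sub>R c)" if "v \<in> span B" for v
    using representation_extend[OF E(1) that E(3)] sum_representation_eq[OF B(1) that B(2)] by simp
qed

lemma linear_functionals_separate:
  fixes v w :: "'v::real_vector"
  assumes "\<And>\<phi> :: 'v \<Rightarrow> real. linear \<phi> \<Longrightarrow> \<phi> v = \<phi> w"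
  shows "v = w"
proof (rule ccontr)
  assume ne: "v \<noteq> w"
  then have ind: "independent {v - w}" by simp
  obtain \<psi> :: "'v \<Rightarrow> 'v \<Rightarrow> real" where \<psi>: "\<And>c. linear (\<psi> c)"
    "\<And>x. x \<in> span {v - w} \<Longrightarrow> x = (\<Sum>c\<in>{v - w}. \<psi> c x *\<^sub>R c)"
    using dual_coordinates[OF ind] by auto
  have "\<psi> (v - w) (v - w) = 0"
    using assms[OF \<psi>(1)[of "v - w"]] linear_diff[OF \<psi>(1)[of "v - w"], of v w] by simp
  moreover have "v - w = \<psi> (v - w) (v - w) *\<^sub>R (v - w)" using \<psi>(2)[of "v - w"] by (simp add: span_base)
  ultimately show False using ne by simp
qed

text \<open>Induction on the generators. The crux is that a new generator b outside span B has a
  positive distance d from it: then the coefficient of b in v is at most norm v / d, and the rest of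
  v falls under the induction hypothesis.\<close>

lemma linear_functional_bounded_on_span:
  fixes \<phi> :: "'v::real_normed_vector \<Rightarrow> real"
  assumes "finite B" "linear \<phi>"
  shows "\<exists>K. \<forall>v\<in>span B. \<bar>\<phi> v\<bar> \<le> K * norm v"
  using assms
proof (induction B arbitrary: \<phi> rule: finite_induct)
  case empty
  then show ?case by (auto simp: linear_0)
next
  case (insert b B)
  show ?case
  proof (cases "b \<in> span B")
    case True
    then show ?thesis using insert.IH[OF insert.prems] by (simp add: span_redundant)
  next
    case False
    have "\<exists>d>0. \<forall>w\<in>span B. d \<le> norm (b + w)"
    proof (rule ccontr)
      assume "\<not> ?thesis"
      then have "\<exists>w\<in>span B. norm (b + w) < inverse (real (Suc n))" for n
        by (meson inverse_positive_iff_positive not_le of_nat_0_less_iff zero_less_Suc)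
      then obtain w where w: "\<And>n. w n \<in> span B" "\<And>n. norm (b + w n) < inverse (real (Suc n))"
        by metis
      have lim0: "(\<lambda>n. b + w n) \<longlonglongrightarrow> 0"
        by (rule Lim_null_comparison[OF _ LIMSEQ_inverse_real_of_nat])
          (use w(2) in \<open>auto intro!: always_eventually less_imp_le\<close>)
      then have wlim: "w \<longlonglongrightarrow> - b"
        using tendsto_diff[OF lim0 tendsto_const[of b]] by simp
      \<comment> \<open>The induction hypothesis holds for every functional, in particular for
        coordinates. So the coordinates of \<open>w n\<close> converge, and the limit -b of
        \<open>w\<close> would lie in span B.\<close>
      have conv: "convergent (\<lambda>n. \<psi> (w n))" if lin: "linear \<psi>" for \<psi> :: "'v \<Rightarrow> real"
      proof -
        obtain K where K: "\<forall>v\<in>span B. \<bar>\<psi> v\<bar> \<le> K * norm v" using insert.IH[OF lin] by blast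
        have "Cauchy (\<lambda>n. \<psi> (w n))"
        proof (rule metric_CauchyI)
          fix e :: real assume e: "0 < e"
          have "Cauchy w" using wlim by (rule LIMSEQ_imp_Cauchy)
          then obtain M where M: "\<forall>m\<ge>M. \<forall>n\<ge>M. dist (w m) (w n) < e / (\<bar>K\<bar> + 1)"
            using e by (meson Cauchy_def abs_ge_zero add_nonneg_pos divide_pos_pos zero_less_one)
          have "dist (\<psi> (w m)) (\<psi> (w n)) < e" if "m \<ge> M" "n \<ge> M" for m n
          proof -
            have "dist (\<psi> (w m)) (\<psi> (w n)) = \<bar>\<psi> (w m - w n)\<bar>"
              by (simp add: dist_real_def linear_diff[OF lin])
            also have "\<dots> \<le> K * norm (w m - w n)" using K w(1) by (simp add: span_diff)
            also have "\<dots> \<le> (\<bar>K\<bar> + 1) * norm (w m - w n)" by (intro mult_right_mono) auto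
            also have "\<dots> < (\<bar>K\<bar> + 1) * (e / (\<bar>K\<bar> + 1))"
              using M that by (intro mult_strict_left_mono) (auto simp: dist_norm)
            also have "\<dots> = e" by simp
            finally show ?thesis .
          qed
          then show "\<exists>M. \<forall>m\<ge>M. \<forall>n\<ge>M. dist (\<psi> (w m)) (\<psi> (w n)) < e" by blast
        qed
        then show ?thesis by (rule real_Cauchy_convergent)
      qed
      obtain B' where B': "B' \<subseteq> B" "independent B'" "B \<subseteq> span B'"
        by (rule maximal_independent_subset)
      have span: "span B' = span B"
        using B' by (meson order_antisym span_minimal span_mono subspace_span)
      have fin: "finite B'" using B'(1) insert.hyps(1) by (rule finite_subset)
      obtain \<psi> :: "'v \<Rightarrow> 'v \<Rightarrow> real" where \<psi>: "\<And>c. linear (\<psi> c)"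
        "\<And>v. v \<in> span B' \<Longrightarrow> v = (\<Sum>c\<in>B'. \<psi> c v *\<^sub>R c)"
        using dual_coordinates[OF B'(2) fin] by blast
      have "(\<lambda>n. \<Sum>c\<in>B'. \<psi> c (w n) *\<^sub>R c) \<longlonglongrightarrow> (\<Sum>c\<in>B'. lim (\<lambda>n. \<psi> c (w n)) *\<^sub>R c)"
        using conv[OF \<psi>(1)] by (intro tendsto_intros) (simp add: convergent_LIMSEQ_iff)
      then have "w \<longlonglongrightarrow> (\<Sum>c\<in>B'. lim (\<lambda>n. \<psi> c (w n)) *\<^sub>R c)"
        using \<psi>(2) w(1) span by simp
      then have "- b = (\<Sum>c\<in>B'. lim (\<lambda>n. \<psi> c (w n)) *\<^sub>R c)"
        using wlim LIMSEQ_unique by blast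
      also have "\<dots> \<in> span B" using B'(1)
        by (intro span_sum span_scale) (auto intro: span_base)
      finally show False using False span_neg[of "- b" B] by simp
    qed
    then obtain d where d: "0 < d" "\<And>w. w \<in> span B \<Longrightarrow> d \<le> norm (b + w)" by blast
    obtain K where K: "\<forall>v\<in>span B. \<bar>\<phi> v\<bar> \<le> K * norm v" using insert.IH[OF insert.prems] by blast
    have "\<bar>\<phi> v\<bar> \<le> (\<bar>K\<bar> + (\<bar>\<phi> b\<bar> + \<bar>K\<bar> * norm b) / d) * norm v" if v: "v \<in> span (insert b B)" for v
    proof -
      obtain a where a: "v - a *\<^sub>R b \<in> span B" using v by (auto simp: span_breakdown_eq)
      define w where "w = v - a *\<^sub>R b"
      have vw: "v = a *\<^sub>R b + w" by (simp add: w_def)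
      have ad: "\<bar>a\<bar> \<le> norm v / d"
      proof (cases "a = 0")
        case False
        have "d \<le> norm (b + (1/a) *\<^sub>R w)" using a by (intro d(2)) (simp add: w_def span_scale)
        then have "\<bar>a\<bar> * d \<le> \<bar>a\<bar> * norm (b + (1/a) *\<^sub>R w)" by (rule mult_left_mono) simp
        also have "\<dots> = norm (a *\<^sub>R (b + (1/a) *\<^sub>R w))" by simp
        also have "a *\<^sub>R (b + (1/a) *\<^sub>R w) = v" using False by (simp add: vw scaleR_right_distrib)
        finally show ?thesis using d(1) by (simp add: field_simps)
      qed (use d(1) in simp)
      have "\<bar>\<phi> v\<bar> \<le> \<bar>a\<bar> * \<bar>\<phi> b\<bar> + \<bar>\<phi> w\<bar>"
        using abs_triangle_ineq[of "a * \<phi> b" "\<phi> w"]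
        by (simp add: vw linear_add[OF insert.prems] linear_scale[OF insert.prems] abs_mult)
      also have "\<bar>\<phi> w\<bar> \<le> \<bar>K\<bar> * norm w"
        using K a mult_right_mono[OF abs_ge_self[of K] norm_ge_zero[of w]]
        unfolding w_def[symmetric] by force
      finally have 1: "\<bar>\<phi> v\<bar> \<le> \<bar>a\<bar> * \<bar>\<phi> b\<bar> + \<bar>K\<bar> * norm w" by simp
      have "norm w \<le> norm v + \<bar>a\<bar> * norm b"
        unfolding w_def using norm_triangle_ineq4[of v "a *\<^sub>R b"] by simp
      then have "\<bar>K\<bar> * norm w \<le> \<bar>K\<bar> * (norm v + \<bar>a\<bar> * norm b)" by (simp add: mult_left_mono)
      with 1 have "\<bar>\<phi> v\<bar> \<le> \<bar>K\<bar> * norm v + \<bar>a\<bar> * (\<bar>\<phi> b\<bar> + \<bar>K\<bar> * norm b)"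
        by (simp add: algebra_simps)
      also have "\<bar>a\<bar> * (\<bar>\<phi> b\<bar> + \<bar>K\<bar> * norm b) \<le> norm v / d * (\<bar>\<phi> b\<bar> + \<bar>K\<bar> * norm b)"
        using ad by (intro mult_right_mono) auto
      finally show ?thesis by (simp add: algebra_simps add_divide_distrib)
    qed
    then show ?thesis by blast
  qed
qed

lemma openin_ftop: "openin ftop U \<longleftrightarrow> fin_open U"
  unfolding ftop_def by (simp add: istopology_fin_open topology_inverse')

text \<open>On each finite-dimensional subspace the functional is Lipschitz by the preceding bound,
  so preimages of open sets are open in the finite topology even if the functional is unbounded on
  the whole space.\<close>

lemma limitin_ftop_linear:
  fixes \<phi> :: "'v::real_normed_vector \<Rightarrow> real"
  assumes lin: "linear \<phi>" and lim: "limitin ftop g l F"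
  shows "((\<lambda>x. \<phi> (g x)) \<longlongrightarrow> \<phi> l) F"
proof (rule topological_tendstoI)
  fix S :: "real set" assume S: "open S" "\<phi> l \<in> S"
  have "openin (top_of_set (span B)) (\<phi> -` S \<inter> span B)" if fin: "finite B" for B
  proof -
    obtain K where K: "\<forall>v\<in>span B. \<bar>\<phi> v\<bar> \<le> K * norm v"
      using linear_functional_bounded_on_span[OF fin lin] by blast
    have "continuous_on (span B) \<phi>"
    proof (rule lipschitz_on_continuous_on)
      show "\<bar>K\<bar>-lipschitz_on (span B) \<phi>"
      proof (rule lipschitz_onI)
        fix x y assume "x \<in> span B" "y \<in> span B"
        then have "\<bar>\<phi> (x - y)\<bar> \<le> K * norm (x - y)" using K by (simp add: span_diff)
        also have "\<dots> \<le> \<bar>K\<bar> * norm (x - y)" by (intro mult_right_mono) auto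
        finally show "dist (\<phi> x) (\<phi> y) \<le> \<bar>K\<bar> * dist x y"
          by (simp add: dist_real_def dist_norm linear_diff[OF lin])
      qed simp
    qed
    from continuous_openin_preimage_gen[OF this S(1)] show ?thesis by (simp add: Int_commute)
  qed
  then have "openin ftop (\<phi> -` S)" by (simp add: openin_ftop fin_open_def)
  with lim S(2) show "\<forall>\<^sub>F x in F. \<phi> (g x) \<in> S" unfolding limitin_def by auto
qed

text \<open>An infinite linearly independent set meets every finite-dimensional subspace in a
  finite set and is therefore closed, so it cannot accumulate.\<close>

lemma limitin_ftop_not_escaping:
  fixes X :: "nat \<Rightarrow> 'v::real_normed_vector"
  assumes lim: "limitin ftop X l sequentially"
  shows "\<exists>n. X n \<in> span (insert l (X ` {..<n}))"
proof (rule ccontr)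
  assume "\<not> ?thesis"
  then have esc: "X n \<notin> span (insert l (X ` {..<n}))" for n by blast
  have esc': "X n \<notin> span (X ` {..<n})" for n
    using esc[of n] span_mono[of "X ` {..<n}" "insert l (X ` {..<n})"] by blast
  have "X m \<noteq> X n" if "m < n" for m n
    using esc'[of n] span_base[of "X m" "X ` {..<n}"] that by auto
  then have inj: "inj X" by (metis injI linorder_neqE_nat)
  have ind: "independent (X ` {..<n})" for n
    by (induction n) (use esc' in \<open>auto simp: lessThan_Suc independent_insert independent_empty\<close>)
  have fin: "finite (range X \<inter> span B)" if B: "finite B" for B
  proof (rule ccontr)
    assume inf: "infinite (range X \<inter> span B)"
    have "range X \<inter> span B = X ` {n. X n \<in> span B}" by auto
    then have "infinite {n. X n \<in> span B}" using inf by auto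
    then obtain N where N: "finite N" "card N = Suc (card B)" "N \<subseteq> {n. X n \<in> span B}"
      using infinite_arbitrarily_large by blast
    obtain k where "N \<subseteq> {..<k}" using N(1) finite_nat_iff_bounded by blast
    then have "independent (X ` N)" using ind independent_mono by (metis image_mono)
    then have "card (X ` N) \<le> card B"
      using independent_span_bound[OF B, of "X ` N"] N(3) by blast
    then show False using N(2) inj by (simp add: card_image inj_on_subset)
  qed
  have "fin_open (- range X)"
    unfolding fin_open_def
  proof (intro allI impI)
    fix B :: "'v set" assume "finite B"
    then have "closed (range X \<inter> span B)" using fin finite_imp_closed by blast
    then have "openin (top_of_set (span B)) (span B \<inter> - (range X \<inter> span B))"
      by (intro openin_open_Int) (simp only: open_Compl)
    moreover have "span B \<inter> - (range X \<inter> span B) = - range X \<inter> span B" by blast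
    ultimately show "openin (top_of_set (span B)) (- range X \<inter> span B)" by simp
  qed
  \<comment> \<open>Having l among the spanning vectors in the negated claim keeps l itself off the
    sequence, so the complement of the range is a neighbourhood of l.\<close>
  moreover have "l \<in> - range X" using esc span_base by (metis ComplI insertI1 rangeE)
  ultimately have "\<forall>\<^sub>F n in sequentially. X n \<in> - range X"
    using lim unfolding limitin_def openin_ftop by blast
  then show False by simp
qed

text \<open>Otherwise points \<open>s n\<close> tending to a could be chosen recursively, each value
  \<open>g (s n)\<close> outside the span of l and the earlier values, which
  \<open>limitin_ftop_not_escaping\<close> excludes.\<close>

lemma limitin_ftop_locally_finite_dim:
  fixes g :: "real \<Rightarrow> 'v::real_normed_vector"
  assumes lim: "limitin ftop g l (at a within I)"
  obtains B d where "finite B" "0 < d" "\<And>s. s \<in> I \<Longrightarrow> s \<noteq> a \<Longrightarrow> \<bar>s - a\<bar> < d \<Longrightarrow> g s \<in> span B"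
proof (rule ccontr)
  note wit = that
  assume contra: "\<not> thesis"
  have ex: "\<exists>s\<in>I. s \<noteq> a \<and> \<bar>s - a\<bar> < d \<and> g s \<notin> span B" if "finite B" "0 < d" for B d
    using wit[OF that] contra by blast
  define P where "P f n r \<longleftrightarrow> r \<in> I \<and> r \<noteq> a \<and> \<bar>r - a\<bar> < inverse (real (Suc n)) \<and>
      g r \<notin> span (insert l ((\<lambda>m. g (f m)) ` {..<n}))" for f :: "nat \<Rightarrow> real" and n r
  have "\<exists>f. \<forall>n. P f n (f n)"
  proof (rule dependent_wellorder_choice)
    fix r and f f' :: "nat \<Rightarrow> real" and n :: nat assume "\<And>m. m < n \<Longrightarrow> f m = f' m"
    then have "(\<lambda>m. g (f m)) ` {..<n} = (\<lambda>m. g (f' m)) ` {..<n}" by auto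
    then show "P f n r = P f' n r" by (simp add: P_def)
  next
    fix n f
    show "\<exists>r. P f n r"
      using ex[of "insert l ((\<lambda>m. g (f m)) ` {..<n})" "inverse (real (Suc n))"] by (auto simp: P_def)
  qed
  then obtain s where s: "\<And>n. P s n (s n)" by blast
  have "(\<lambda>n. s n - a) \<longlonglongrightarrow> 0"
    by (rule Lim_null_comparison[OF _ LIMSEQ_inverse_real_of_nat])
      (use s in \<open>auto simp: P_def intro!: always_eventually less_imp_le\<close>)
  then have "s \<longlonglongrightarrow> a" by (simp add: LIM_zero_iff)
  then have "filterlim s (at a within I) sequentially"
    using s by (auto simp: filterlim_at P_def)
  then have "limitin ftop (\<lambda>n. g (s n)) l sequentially"
    using lim unfolding limitin_def filterlim_iff by blast
  then obtain n where "g (s n) \<in> span (insert l ((\<lambda>n. g (s n)) ` {..<n}))"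
    using limitin_ftop_not_escaping by blast
  then show False using s[of n] by (simp add: P_def)
qed

section \<open>Multilinear functions and twisting series\<close>

text \<open>No arity is fixed: one function on lists stands for the whole sequence of brackets, so
  that inserting further copies of u stays inside the same function.\<close>

definition multilinear :: "('v::real_vector list \<Rightarrow> real) \<Rightarrow> bool" where
  "multilinear A \<longleftrightarrow> (\<forall>xs ys a b y z.
     A (xs @ (a *\<^sub>R y + b *\<^sub>R z) # ys) = a * A (xs @ y # ys) + b * A (xs @ z # ys))"

lemma multilinear_add_scale:
  assumes "multilinear A"
  shows "A (xs @ (z + s *\<^sub>R b) # ys) = A (xs @ z # ys) + s * A (xs @ b # ys)"
  using assms[unfolded multilinear_def, rule_format, of xs 1 z s b ys] by simp

lemma multilinear_scale:
  assumes "multilinear A"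
  shows "A (xs @ (s *\<^sub>R b) # ys) = s * A (xs @ b # ys)"
  using assms[unfolded multilinear_def, rule_format, of xs s b 0 0 ys] by simp

lemma multilinear_sum:
  assumes A: "multilinear A" and "finite J"
  shows "A (xs @ (\<Sum>j\<in>J. c j *\<^sub>R x j) # ys) = (\<Sum>j\<in>J. c j * A (xs @ x j # ys))"
  using assms(2)
proof (induction J rule: finite_induct)
  case empty
  then show ?case using multilinear_scale[OF A, of xs 0 0 ys] by simp
next
  case (insert i J)
  then show ?case
    using multilinear_add_scale[OF A, of xs "\<Sum>j\<in>J. c j *\<^sub>R x j" "c i" "x i" ys]
    by (simp add: add.commute)
qed

lemma multilinear_scale_replicate:
  assumes "multilinear A"
  shows "A (xs @ replicate k (s *\<^sub>R b) @ ys) = s ^ k * A (xs @ replicate k b @ ys)"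
proof (induction k arbitrary: xs)
  case (Suc k)
  then show ?case
    using multilinear_scale[OF assms, of xs s b] Suc[of "xs @ [b]"] by simp
qed simp

lemma sum_lists_Suc:
  assumes "finite J"
  shows "(\<Sum>js\<in>{js. set js \<subseteq> J \<and> length js = Suc p}. f js) =
         (\<Sum>j\<in>J. \<Sum>js\<in>{js. set js \<subseteq> J \<and> length js = p}. f (j # js))"
proof -
  let ?S = "{js. set js \<subseteq> J \<and> length js = p}"
  have "{js. set js \<subseteq> J \<and> length js = Suc p} = (\<lambda>(j, js). j # js) ` (J \<times> ?S)"
    by (auto simp: length_Suc_conv image_iff)
  moreover have "inj_on (\<lambda>(j, js). j # js) (J \<times> ?S)" by (auto simp: inj_on_def)
  ultimately show ?thesis
    using finite_lists_length_eq[OF assms, of p]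
    by (simp add: sum.reindex sum.cartesian_product o_def case_prod_unfold)
qed

lemma multilinear_expand:
  assumes A: "multilinear A" and J: "finite J"
  shows "A (xs @ replicate p (\<Sum>j\<in>J. c j *\<^sub>R x j) @ ys) =
    (\<Sum>js\<in>{js. set js \<subseteq> J \<and> length js = p}. prod_list (map c js) * A (xs @ map x js @ ys))"
proof (induction p arbitrary: xs)
  case 0
  have "{js. set js \<subseteq> J \<and> length js = 0} = {[]}" by auto
  then show ?case by simp
next
  case (Suc p)
  have "A (xs @ replicate (Suc p) (\<Sum>j\<in>J. c j *\<^sub>R x j) @ ys) =
      (\<Sum>j\<in>J. c j * A ((xs @ [x j]) @ replicate p (\<Sum>j\<in>J. c j *\<^sub>R x j) @ ys))"
    using multilinear_sum[OF A J, of xs c x] by simp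
  also have "\<dots> = (\<Sum>j\<in>J. \<Sum>js\<in>{js. set js \<subseteq> J \<and> length js = p}.
      prod_list (map c (j # js)) * A (xs @ map x (j # js) @ ys))"
    unfolding Suc by (simp add: sum_distrib_left mult.assoc)
  finally show ?case using J by (simp only: sum_lists_Suc)
qed

lemma multilinear_line_poly:
  assumes A: "multilinear A"
  shows "\<exists>P. degree P \<le> k \<and> (\<forall>s. poly P s = A (xs @ replicate k (z + s *\<^sub>R b) @ ys))"
proof (induction k arbitrary: xs)
  case 0
  show ?case by (rule exI[of _ "[:A (xs @ ys):]"]) simp
next
  case (Suc k)
  obtain P Q where P: "degree P \<le> k" "\<And>s. poly P s = A ((xs @ [z]) @ replicate k (z + s *\<^sub>R b) @ ys)"
    and Q: "degree Q \<le> k" "\<And>s. poly Q s = A ((xs @ [b]) @ replicate k (z + s *\<^sub>R b) @ ys)"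
    using Suc by metis
  have "degree (P + pCons 0 Q) \<le> Suc k"
    using P(1) Q(1) by (intro degree_add_le) (auto intro: order_trans[OF degree_pCons_le])
  moreover have "poly (P + pCons 0 Q) s = A (xs @ replicate (Suc k) (z + s *\<^sub>R b) @ ys)" for s
    using P(2) Q(2) multilinear_add_scale[OF A, of xs z s b] by simp
  ultimately show ?case by blast
qed

text \<open>Only neighbours from \<open>S\<close> are exchanged, while the remaining entries are
  arbitrary. \<open>S\<close> will be the degree-zero part, where graded symmetry carries no
  sign.\<close>

definition symmetric_on :: "'v set \<Rightarrow> ('v list \<Rightarrow> real) \<Rightarrow> bool" where
  "symmetric_on S A \<longleftrightarrow> (\<forall>xs ys. \<forall>x\<in>S. \<forall>y\<in>S. A (xs @ x # y # ys) = A (xs @ y # x # ys))"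

lemma symmetric_on_move:
  assumes A: "symmetric_on S A" and w: "w \<in> S" "b \<in> S"
  shows "A (xs @ b # replicate k w @ ys) = A (xs @ replicate k w @ b # ys)"
proof (induction k arbitrary: xs)
  case (Suc k)
  have "A (xs @ b # w # replicate k w @ ys) = A ((xs @ [w]) @ b # replicate k w @ ys)"
    using A w by (auto simp: symmetric_on_def)
  then show ?case using Suc[of "xs @ [w]"] by simp
qed simp

text \<open>The product rule produces one term for each of the k slots, and symmetry moves the
  differentiated entry b to the end of the block in each of them. There it can be read as a further
  argument, so the derivative again has the shape of a twisting term.\<close>

lemma multilinear_line_deriv:
  assumes A: "multilinear A" and sym: "symmetric_on S A" and S: "subspace S" "z \<in> S" "b \<in> S"
  shows "((\<lambda>s. A (xs @ replicate k (z + s *\<^sub>R b) @ ys)) has_field_derivative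
      real k * A (xs @ replicate (k - 1) (z + s *\<^sub>R b) @ b # ys)) (at s within T)"
proof (induction k arbitrary: xs)
  case 0
  show ?case by simp
next
  case (Suc k)
  let ?w = "\<lambda>s. z + s *\<^sub>R b"
  have w: "?w s \<in> S" for s using S by (simp add: subspace_add subspace_scale)
  have "(\<lambda>s. A (xs @ replicate (Suc k) (?w s) @ ys)) =
      (\<lambda>s. A ((xs @ [z]) @ replicate k (?w s) @ ys) + s * A ((xs @ [b]) @ replicate k (?w s) @ ys))"
    using multilinear_add_scale[OF A, of xs z _ b] by simp
  moreover have "((\<lambda>s. A ((xs @ [z]) @ replicate k (?w s) @ ys) + s * A ((xs @ [b]) @ replicate k (?w s) @ ys))
      has_field_derivative
        real k * A ((xs @ [z]) @ replicate (k - 1) (?w s) @ b # ys)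
        + (1 * A ((xs @ [b]) @ replicate k (?w s) @ ys)
           + real k * A ((xs @ [b]) @ replicate (k - 1) (?w s) @ b # ys) * s)) (at s within T)"
    by (intro DERIV_add DERIV_mult Suc DERIV_ident)
  moreover have "real k * A ((xs @ [z]) @ replicate (k - 1) (?w s) @ b # ys)
        + (1 * A ((xs @ [b]) @ replicate k (?w s) @ ys)
           + real k * A ((xs @ [b]) @ replicate (k - 1) (?w s) @ b # ys) * s)
      = real (Suc k) * A (xs @ replicate k (?w s) @ b # ys)"
  \<comment> \<open>For positive k the two terms with factor k recombine by linearity in the first
    slot, and the middle term equals the same value after moving b through the block. For k = 0 the
    truncated k - 1 is harmless because its factor is 0.\<close>
  proof (cases k)
    case 0
    then show ?thesis by simp
  next
    case (Suc l)
    have "A (xs @ replicate k (?w s) @ b # ys) =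
        A ((xs @ [z]) @ replicate (k - 1) (?w s) @ b # ys) + s * A ((xs @ [b]) @ replicate (k - 1) (?w s) @ b # ys)"
      using multilinear_add_scale[OF A, of xs z s b] Suc by simp
    moreover have "A ((xs @ [b]) @ replicate k (?w s) @ ys) = A (xs @ replicate k (?w s) @ b # ys)"
      using symmetric_on_move[OF sym w S(3), of xs k s ys] by simp
    ultimately show ?thesis by (simp add: algebra_simps)
  qed
  ultimately show ?case by (simp only: diff_Suc_1)
qed

section \<open>Twisting series: uniform decay, derivatives and Taylor expansion\<close>

definition twist_term :: "('v list \<Rightarrow> real) \<Rightarrow> 'v \<Rightarrow> 'v list \<Rightarrow> nat \<Rightarrow> real" where
  "twist_term A w vs k = A (replicate k w @ vs) / fact k"

text \<open>The bound is made uniform one coordinate at a time: in each step the coordinates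
  treated earlier only enter as an index of a family of polynomials in the next coordinate.\<close>

lemma twist_term_box_bound:
  fixes x :: "'j \<Rightarrow> 'v::real_vector"
  assumes A: "multilinear A" and J: "finite J" and R: "0 < R" and q: "0 < q" "q < q'"
    and bd: "\<And>s. (\<And>j. j \<in> J \<Longrightarrow> \<bar>s j\<bar> \<le> R) \<Longrightarrow>
      \<exists>C. \<forall>k. \<bar>twist_term A (u + (\<Sum>j\<in>J. s j *\<^sub>R x j)) vs k\<bar> \<le> C * q ^ k"
  shows "\<exists>C. \<forall>s k. (\<forall>j\<in>J. \<bar>s j\<bar> \<le> R / 2) \<longrightarrow>
      \<bar>twist_term A (u + (\<Sum>j\<in>J. s j *\<^sub>R x j)) vs k\<bar> \<le> C * q' ^ k"
proof -
  define p where "p s = u + (\<Sum>j\<in>J. s j *\<^sub>R x j)" for s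
  \<comment> \<open>J' holds the coordinates that already range over the half box, the others being
    frozen at s0. The claim covers every rate above q, so that each induction step can spend part of
    the slack.\<close>
  have gen: "\<exists>C. \<forall>s k. (\<forall>j\<in>J - J'. s j = s0 j) \<longrightarrow> (\<forall>j\<in>J'. \<bar>s j\<bar> \<le> R / 2) \<longrightarrow>
      \<bar>twist_term A (p s) vs k\<bar> \<le> C * q' ^ k"
    if "finite J'" "J' \<subseteq> J" "q < q'" "\<And>j. j \<in> J - J' \<Longrightarrow> \<bar>s0 j\<bar> \<le> R" for J' s0 q'
    using that
  proof (induction J' arbitrary: s0 q' rule: finite_induct)
    case empty
    obtain C where C: "\<And>k. \<bar>twist_term A (p s0) vs k\<bar> \<le> C * q ^ k"
      using bd[of s0] empty unfolding p_def by blast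
    have "\<bar>twist_term A (p s) vs k\<bar> \<le> \<bar>C\<bar> * q' ^ k" if "\<forall>j\<in>J. s j = s0 j" for s k
    proof -
      have "p s = p s0" using that by (simp add: p_def)
      then have "\<bar>twist_term A (p s) vs k\<bar> \<le> C * q ^ k" using C by simp
      also have "\<dots> \<le> \<bar>C\<bar> * q' ^ k" using q(1) empty by (intro mult_mono power_mono) auto
      finally show ?thesis .
    qed
    then show ?case by auto
  next
    case (insert i J')
    \<comment> \<open>The induction hypothesis is used at the rate q'' and
      \<open>polynomial_family_bound\<close> raises it to q'. The coordinates treated so far form
      its index set \<open>Ix\<close>, coordinate i is its variable.\<close>
    define q'' where "q'' = (q + q') / 2"
    have q'': "q < q''" "q'' < q'" "0 < q''" using q(1) insert.prems by (auto simp: q''_def)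
    define Ix where "Ix = {s. (\<forall>j\<in>J - insert i J'. s j = s0 j) \<and> (\<forall>j\<in>J'. \<bar>s j\<bar> \<le> R / 2)}"
    have i: "i \<in> J" "i \<notin> J'" using insert by auto
    have "\<exists>C. \<forall>r s k. \<bar>r\<bar> \<le> R / 2 \<longrightarrow> s \<in> Ix \<longrightarrow> \<bar>twist_term A (p (s(i := r))) vs k\<bar> \<le> C * q' ^ k"
    proof (rule polynomial_family_bound[OF R q''(3,2)])
      fix s k
      have "p (s(i := r)) = (u + (\<Sum>j\<in>J - {i}. s j *\<^sub>R x j)) + r *\<^sub>R x i" for r
        using J i by (simp add: p_def sum.remove[of J i] cong: sum.cong_simp)
      then have *: "twist_term A (p (s(i := r))) vs k =
          A ([] @ replicate k ((u + (\<Sum>j\<in>J - {i}. s j *\<^sub>R x j)) + r *\<^sub>R x i) @ vs) / fact k" for r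
        by (simp add: twist_term_def)
      obtain P where P: "degree P \<le> k"
        "\<And>r. poly P r = A ([] @ replicate k ((u + (\<Sum>j\<in>J - {i}. s j *\<^sub>R x j)) + r *\<^sub>R x i) @ vs)"
        using multilinear_line_poly[OF A, of k "[]" "u + (\<Sum>j\<in>J - {i}. s j *\<^sub>R x j)" "x i" vs] by blast
      show "\<exists>P. degree P \<le> k \<and> (\<forall>r. poly P r = twist_term A (p (s(i := r))) vs k)"
        using P by (intro exI[of _ "smult (1 / fact k) P"]) (simp add: *)
    next
      fix r :: real assume r: "\<bar>r\<bar> \<le> R"
      have "\<bar>(s0(i := r)) j\<bar> \<le> R" if "j \<in> J - J'" for j
        using insert.prems(3)[of j] r that by auto
      then obtain C where C: "\<And>s k. (\<forall>j\<in>J - J'. s j = (s0(i := r)) j) \<Longrightarrow> (\<forall>j\<in>J'. \<bar>s j\<bar> \<le> R / 2) \<Longrightarrow>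
          \<bar>twist_term A (p s) vs k\<bar> \<le> C * q'' ^ k"
        using insert.IH[of q'' "s0(i := r)"] insert.prems(1) q''(1) by blast
      have "\<bar>twist_term A (p (s(i := r))) vs k\<bar> \<le> C * q'' ^ k" if "s \<in> Ix" for s k
        using that i by (intro C) (auto simp: Ix_def)
      then show "\<exists>C. \<forall>s\<in>Ix. \<forall>k. \<bar>twist_term A (p (s(i := r))) vs k\<bar> \<le> C * q'' ^ k" by blast
    qed
    then obtain C where C: "\<And>r s k. \<bar>r\<bar> \<le> R / 2 \<Longrightarrow> s \<in> Ix \<Longrightarrow>
        \<bar>twist_term A (p (s(i := r))) vs k\<bar> \<le> C * q' ^ k" by blast
    have "\<bar>twist_term A (p s) vs k\<bar> \<le> C * q' ^ k"
      if "\<forall>j\<in>J - insert i J'. s j = s0 j" "\<forall>j\<in>insert i J'. \<bar>s j\<bar> \<le> R / 2" for s k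
      using C[of "s i" s k] that by (simp add: Ix_def)
    then show ?case by blast
  qed
  from gen[of J q' "\<lambda>_. 0"] show ?thesis using J q(2) by (simp add: p_def)
qed

lemma twist_term_summable:
  assumes "\<And>k. \<bar>twist_term A w vs k\<bar> \<le> C * \<theta> ^ k" "0 < \<theta>" "\<theta> < 1"
  shows "summable (twist_term A w vs)" "\<bar>suminf (twist_term A w vs)\<bar> \<le> C / (1 - \<theta>)"
proof -
  have s: "(\<lambda>k. C * \<theta> ^ k) sums (C * (1 / (1 - \<theta>)))"
    using assms by (intro sums_mult geometric_sums) auto
  show sm: "summable (twist_term A w vs)"
    using assms(1) by (intro summable_comparison_test'[OF sums_summable[OF s], of 0]) auto
  show "\<bar>suminf (twist_term A w vs)\<bar> \<le> C / (1 - \<theta>)"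
    using norm_suminf_le[OF _ sums_summable[OF s], of "twist_term A w vs"] assms(1) sums_unique[OF s] by simp
qed

text \<open>Termwise differentiation: the derivative of the k-th term is the term of index k - 1
  with h as an additional argument, as for the exponential series. The geometric bound for the
  arguments h # vs supplies the uniform convergence.\<close>

lemma twist_deriv:
  assumes A: "multilinear A" and sym: "symmetric_on S A" and S: "subspace S" "u \<in> S" "h \<in> S"
    and \<theta>: "0 < \<theta>" "\<theta> < 1"
    and bd: "\<And>vs. \<exists>C. \<forall>s\<in>{0..1}. \<forall>k. \<bar>twist_term A (u + s *\<^sub>R h) vs k\<bar> \<le> C * \<theta> ^ k"
    and s: "s \<in> {0..1}"
  shows "((\<lambda>s. suminf (twist_term A (u + s *\<^sub>R h) vs)) has_field_derivative
      suminf (twist_term A (u + s *\<^sub>R h) (h # vs))) (at s within {0..1})"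
proof -
  let ?w = "\<lambda>s. u + s *\<^sub>R h"
  \<comment> \<open>The index shift leaves the constant term with derivative 0. It is also the
    reason for the quotient C / \<theta> in the majorant.\<close>
  define f' where "f' k s = (if k = 0 then 0 else twist_term A (?w s) (h # vs) (k - 1))" for k s
  obtain C where C: "\<And>s k. s \<in> {0..1} \<Longrightarrow> \<bar>twist_term A (?w s) (h # vs) k\<bar> \<le> C * \<theta> ^ k"
    using bd by blast
  obtain C' where C': "\<And>s k. s \<in> {0..1} \<Longrightarrow> \<bar>twist_term A (?w s) vs k\<bar> \<le> C' * \<theta> ^ k"
    using bd by blast
  have C0: "0 \<le> C" using C[of 0 0] by force
  have "\<exists>g. \<forall>s\<in>{0..1}. (\<lambda>k. twist_term A (?w s) vs k) sums g s \<and>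
      (g has_field_derivative suminf (\<lambda>k. f' k s)) (at s within {0..1})"
  proof (rule has_field_derivative_series)
    show "((\<lambda>s. twist_term A (?w s) vs k) has_field_derivative f' k s) (at s within {0..1})"
      if "s \<in> {0..1}" for k s
    proof -
      have "f' k s = real k * A ([] @ replicate (k - 1) (?w s) @ h # vs) / fact k"
        by (cases k) (auto simp: f'_def twist_term_def simp del: of_nat_Suc)
      then show ?thesis
        using DERIV_cdivide[OF multilinear_line_deriv[OF A sym S, of "[]" k vs s "{0..1}"], of "fact k"]
        by (simp add: twist_term_def)
    qed
    show "uniform_limit {0..1} (\<lambda>n s. \<Sum>k<n. f' k s) (\<lambda>s. suminf (\<lambda>k. f' k s)) sequentially"
    proof (rule Weierstrass_m_test)
      show "norm (f' k s) \<le> (C / \<theta>) * \<theta> ^ k" if "s \<in> {0..1}" for k s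
        using C[OF that, of "k - 1"] \<theta> C0 by (cases k) (auto simp: f'_def)
      show "summable (\<lambda>k. (C / \<theta>) * \<theta> ^ k)"
        using \<theta> by (intro summable_mult summable_geometric) auto
    qed
    show "(0::real) \<in> {0..1}" by simp
    show "summable (\<lambda>k. twist_term A (?w 0) vs k)"
      using twist_term_summable(1)[OF C'[of 0] \<theta>] by simp
  qed auto
  then obtain g where g: "\<And>s. s \<in> {0..1} \<Longrightarrow> (\<lambda>k. twist_term A (?w s) vs k) sums g s"
    "\<And>s. s \<in> {0..1} \<Longrightarrow> (g has_field_derivative suminf (\<lambda>k. f' k s)) (at s within {0..1})" by blast
  have "suminf (\<lambda>k. f' k s) = suminf (twist_term A (?w s) (h # vs))"
  proof -
    have "(\<lambda>k. f' (Suc k) s) sums suminf (twist_term A (?w s) (h # vs))"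
      using summable_sums[OF twist_term_summable(1)[OF C[OF s] \<theta>]] by (simp add: f'_def)
    then have "(\<lambda>k. f' k s) sums (suminf (twist_term A (?w s) (h # vs)) + f' 0 s)" by (rule sums_Suc)
    then show ?thesis by (simp add: f'_def sums_iff)
  qed
  then have "(g has_field_derivative suminf (twist_term A (?w s) (h # vs))) (at s within {0..1})"
    using g(2)[OF s] by simp
  then show ?thesis
    by (rule has_field_derivative_transform_within[OF _ zero_less_one s]) (use g(1) in \<open>simp add: sums_iff\<close>)
qed

lemma multilinear_twist:
  assumes A: "multilinear A" and sm: "\<And>vs. summable (twist_term A w vs)"
  shows "multilinear (\<lambda>vs. suminf (twist_term A w vs))"
  unfolding multilinear_def
proof (intro allI)
  fix xs ys a b y z
  have "twist_term A w (xs @ (a *\<^sub>R y + b *\<^sub>R z) # ys) =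
      (\<lambda>k. a * twist_term A w (xs @ y # ys) k + b * twist_term A w (xs @ z # ys) k)"
    using A[unfolded multilinear_def, rule_format, of "replicate _ w @ xs" a y b z ys]
    by (auto simp: twist_term_def add_divide_distrib)
  then show "suminf (twist_term A w (xs @ (a *\<^sub>R y + b *\<^sub>R z) # ys)) =
      a * suminf (twist_term A w (xs @ y # ys)) + b * suminf (twist_term A w (xs @ z # ys))"
    using sm by (simp add: suminf_add[symmetric] suminf_mult summable_mult)
qed

lemma abs_prod_list_le_power:
  fixes \<gamma> :: "'j \<Rightarrow> real"
  assumes "\<And>j. j \<in> set js \<Longrightarrow> \<bar>\<gamma> j\<bar> \<le> \<tau>"
  shows "\<bar>prod_list (map \<gamma> js)\<bar> \<le> \<tau> ^ length js"
  using assms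
proof (induction js)
  case (Cons j js)
  have "\<bar>\<gamma> j\<bar> * \<bar>prod_list (map \<gamma> js)\<bar> \<le> \<tau> * \<tau> ^ length js"
    using Cons by (intro mult_mono) force+
  then show ?case by (simp add: abs_mult)
qed simp

text \<open>One-variable Taylor formula for s in [0, 1] along u + s h, where the i-th derivative is
  the twist with i arguments h. The last derivative is expanded into words in the vectors
  \<open>x j\<close>: each word carries n + 1 coefficients, whence the power of \<tau>, and there
  are finitely many words, whence a constant that does not depend on h.\<close>

lemma twist_taylor_bound:
  fixes x :: "'j \<Rightarrow> 'v::real_vector"
  assumes A: "multilinear A" and sym: "symmetric_on S A" and S: "subspace S" "u \<in> S" "\<And>j. j \<in> J \<Longrightarrow> x j \<in> S"
    and J: "finite J" and \<theta>: "0 < \<theta>" "\<theta> < 1"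
    and bd: "\<And>vs. \<exists>C. \<forall>s k. (\<forall>j\<in>J. \<bar>s j\<bar> \<le> r) \<longrightarrow>
      \<bar>twist_term A (u + (\<Sum>j\<in>J. s j *\<^sub>R x j)) vs k\<bar> \<le> C * \<theta> ^ k"
  shows "\<exists>C. \<forall>\<gamma> \<tau>. (\<forall>j\<in>J. \<bar>\<gamma> j\<bar> \<le> \<tau>) \<longrightarrow> 0 \<le> \<tau> \<longrightarrow> \<tau> \<le> r \<longrightarrow>
    \<bar>suminf (twist_term A (u + (\<Sum>j\<in>J. \<gamma> j *\<^sub>R x j)) [])
      - (\<Sum>p\<le>n. suminf (twist_term A u (replicate p (\<Sum>j\<in>J. \<gamma> j *\<^sub>R x j))) / fact p)\<bar> \<le> C * \<tau> ^ Suc n"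
proof -
  obtain C where C: "\<And>vs s k. (\<And>j. j \<in> J \<Longrightarrow> \<bar>s j\<bar> \<le> r) \<Longrightarrow>
      \<bar>twist_term A (u + (\<Sum>j\<in>J. s j *\<^sub>R x j)) vs k\<bar> \<le> C vs * \<theta> ^ k"
    using bd by metis
  let ?Js = "{js. set js \<subseteq> J \<and> length js = Suc n}"
  define B where "B = (\<Sum>js\<in>?Js. \<bar>C (map x js)\<bar> / (1 - \<theta>))"
  have "\<bar>suminf (twist_term A (u + (\<Sum>j\<in>J. \<gamma> j *\<^sub>R x j)) [])
      - (\<Sum>p\<le>n. suminf (twist_term A u (replicate p (\<Sum>j\<in>J. \<gamma> j *\<^sub>R x j))) / fact p)\<bar> \<le> B / fact n * \<tau> ^ Suc n"
    if \<gamma>: "\<And>j. j \<in> J \<Longrightarrow> \<bar>\<gamma> j\<bar> \<le> \<tau>" and \<tau>: "0 \<le> \<tau>" "\<tau> \<le> r" for \<gamma> \<tau>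
  proof -
    define h where "h = (\<Sum>j\<in>J. \<gamma> j *\<^sub>R x j)"
    have hS: "h \<in> S" unfolding h_def using S by (intro subspace_sum subspace_scale) auto
    define f where "f i s = suminf (twist_term A (u + s *\<^sub>R h) (replicate i h))" for i s
    have tt: "\<bar>twist_term A (u + s *\<^sub>R h) vs k\<bar> \<le> C vs * \<theta> ^ k" if s: "s \<in> {0..1}" for s vs k
    proof -
      have "\<bar>s * \<gamma> j\<bar> \<le> r" if "j \<in> J" for j
        using mult_mono[of "\<bar>s\<bar>" 1 "\<bar>\<gamma> j\<bar>" \<tau>] \<gamma>[OF that] \<tau> s by (simp add: abs_mult)
      moreover have "s *\<^sub>R h = (\<Sum>j\<in>J. (s * \<gamma> j) *\<^sub>R x j)" by (simp add: h_def scaleR_sum_right)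
      ultimately show ?thesis using C[of "\<lambda>j. s * \<gamma> j"] by simp
    qed
    have "norm (f 0 1 - (\<Sum>i\<le>n. f i 0 * (1 - 0) ^ i / fact i)) \<le> (B * \<tau> ^ Suc n) * norm (1 - 0 :: real) ^ Suc n / fact n"
    proof (rule field_Taylor[of "{0..1}"])
      show "(f i has_field_derivative f (Suc i) s) (at s within {0..1})" if "s \<in> {0..1}" "i \<le> n" for i s
        unfolding f_def replicate_Suc
        using tt that(1) by (intro twist_deriv[OF A sym S(1,2) hS \<theta>]) blast+
      show "norm (f (Suc n) s) \<le> B * \<tau> ^ Suc n" if s: "s \<in> {0..1}" for s
      proof -
        let ?G = "\<lambda>vs. suminf (twist_term A (u + s *\<^sub>R h) vs)"
        have "multilinear ?G" using twist_term_summable(1)[OF tt[OF s] \<theta>] by (rule multilinear_twist[OF A])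
        then have "f (Suc n) s = (\<Sum>js\<in>?Js. prod_list (map \<gamma> js) * ?G (map x js))"
          unfolding f_def h_def using multilinear_expand[of ?G J "[]" "Suc n" \<gamma> x "[]"] J by (simp add: h_def)
        also have "\<bar>\<dots>\<bar> \<le> (\<Sum>js\<in>?Js. \<bar>prod_list (map \<gamma> js) * ?G (map x js)\<bar>)" by (rule sum_abs)
        also have "\<dots> \<le> (\<Sum>js\<in>?Js. \<tau> ^ Suc n * (\<bar>C (map x js)\<bar> / (1 - \<theta>)))"
        proof (rule sum_mono)
          fix js assume js: "js \<in> ?Js"
          have "\<bar>prod_list (map \<gamma> js)\<bar> \<le> \<tau> ^ Suc n"
            using abs_prod_list_le_power[of js \<gamma> \<tau>] \<gamma> js by auto
          moreover have "\<bar>?G (map x js)\<bar> \<le> \<bar>C (map x js)\<bar> / (1 - \<theta>)"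
            using twist_term_summable(2)[OF tt[OF s] \<theta>, of "map x js"] \<theta>
            by (elim order_trans) (simp add: divide_right_mono)
          ultimately show "\<bar>prod_list (map \<gamma> js) * ?G (map x js)\<bar> \<le> \<tau> ^ Suc n * (\<bar>C (map x js)\<bar> / (1 - \<theta>))"
            unfolding abs_mult using \<tau> by (intro mult_mono) auto
        qed
        also have "\<dots> = B * \<tau> ^ Suc n" by (simp add: B_def sum_distrib_left mult.commute)
        finally show ?thesis by simp
      qed
    qed auto
    then show ?thesis by (simp add: f_def h_def)
  qed
  then show ?thesis by blast
qed

section \<open>Extracting a Taylor coefficient from a flatness estimate\<close>

lemma poly_coeff_zero_of_flat:
  fixes Q :: "real poly"
  assumes lim: "0 islimpt X" and bd: "\<And>t. t \<in> X \<Longrightarrow> t \<noteq> 0 \<Longrightarrow> \<bar>poly Q t\<bar> \<le> C * \<bar>t\<bar> ^ n" and m: "m < n"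
  shows "coeff Q m = 0"
  using bd m
proof (induction n arbitrary: Q m)
  case (Suc n)
  obtain a P where Q: "Q = pCons a P" by (cases Q)
  have nt: "at 0 within X \<noteq> bot" using lim by (simp add: trivial_limit_within)
  have "((\<lambda>t. C * \<bar>t\<bar> ^ Suc n) \<longlongrightarrow> C * \<bar>0\<bar> ^ Suc n) (at 0 within X)"
    by (intro tendsto_intros)
  moreover have "\<forall>\<^sub>F t in at 0 within X. norm (poly Q t) \<le> C * \<bar>t\<bar> ^ Suc n"
    using Suc.prems(1) by (auto simp: eventually_at intro!: exI[of _ 1])
  ultimately have "(poly Q \<longlongrightarrow> 0) (at 0 within X)"
    by (intro Lim_null_comparison[of "poly Q"]) auto
  moreover have "(poly Q \<longlongrightarrow> poly Q 0) (at 0 within X)"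
    by (intro tendsto_poly tendsto_ident_at)
  ultimately have "poly Q 0 = 0" using tendsto_unique[OF nt] by blast
  then have a: "a = 0" by (simp add: Q)
  \<comment> \<open>With the constant coefficient gone, division by t lowers the order of flatness
    by one and shifts the coefficients.\<close>
  have nz: "\<bar>poly P t\<bar> \<le> C * \<bar>t\<bar> ^ n" if "t \<in> X" "t \<noteq> 0" for t
    using Suc.prems(1)[OF that] that(2) by (simp add: Q a abs_mult)
  show ?case
  proof (cases m)
    case (Suc l)
    then show ?thesis using Suc.IH[OF nz, of l] Suc.prems(2) by (simp add: Q)
  qed (simp add: Q a)
qed simp

text \<open>Inserting the expansion of h into the sum over p gives a polynomial in t plus terms of
  order n + 1. Flatness of the whole forces the coefficient of t^n to vanish, and this coefficient
  is the displayed sum over compositions of n.\<close>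

lemma composite_coefficient_zero:
  fixes v :: "nat \<Rightarrow> 'v::real_vector" and \<beta> :: "'v \<Rightarrow> real \<Rightarrow> real"
  assumes T: "multilinear T" and B: "finite B" and K: "1 \<le> K"
    and X: "0 islimpt X" "\<And>t. t \<in> X \<Longrightarrow> \<bar>t\<bar> \<le> 1"
    and h: "\<And>t. t \<in> X \<Longrightarrow> h t = (\<Sum>r=1..n. (t ^ r / fact r) *\<^sub>R v r) + (\<Sum>b\<in>B. \<beta> b t *\<^sub>R b)"
    and \<beta>: "\<And>b t. b \<in> B \<Longrightarrow> t \<in> X \<Longrightarrow> \<bar>\<beta> b t\<bar> \<le> K * \<bar>t\<bar> ^ Suc n"
    and flat: "\<And>t. t \<in> X \<Longrightarrow> \<bar>\<Sum>p\<le>n. T (replicate p (h t)) / fact p\<bar> \<le> C * \<bar>t\<bar> ^ Suc n"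
  shows "(\<Sum>p\<le>n. \<Sum>rs\<in>{rs. set rs \<subseteq> {1..n} \<and> length rs = p \<and> sum_list rs = n}.
            T (map v rs) / (fact p * prod_list (map fact rs))) = 0"
proof -
  define J where "J = {1..n} <+> B"
  have J: "finite J" using B by (simp add: J_def)
  define \<gamma> where "\<gamma> t j = (case j of Inl r \<Rightarrow> t ^ r / fact r | Inr b \<Rightarrow> \<beta> b t)" for t and j :: "nat + 'v"
  define x where "x j = (case j of Inl r \<Rightarrow> v r | Inr b \<Rightarrow> b)" for j :: "nat + 'v"
  \<comment> \<open>The order of vanishing in t of the coefficient of a letter: r for the Taylor
    term \<open>Inl r\<close>, n + 1 for a remainder \<open>Inr b\<close>. One remainder letter
    suffices to make a whole word negligible.\<close>
  define wt where "wt j = (case j of Inl r \<Rightarrow> r | Inr b \<Rightarrow> Suc n)" for j :: "nat + 'v"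
  have hx: "h t = (\<Sum>j\<in>J. \<gamma> t j *\<^sub>R x j)" if "t \<in> X" for t
    unfolding h[OF that] J_def using B by (simp add: sum.Plus \<gamma>_def x_def o_def)
  define Lp where "Lp p = {rs. set rs \<subseteq> {1..n} \<and> length rs = p}" for p
  define Jp where "Jp p = {js. set js \<subseteq> J \<and> length js = p}" for p
  have fin: "finite (Lp p)" "finite (Jp p)" for p
    using J by (auto simp: Lp_def Jp_def intro!: finite_lists_length_eq)
  have sub: "map Inl ` Lp p \<subseteq> Jp p" for p by (auto simp: Lp_def Jp_def J_def)
  have wt_bd: "\<bar>prod_list (map (\<gamma> t) js)\<bar> \<le> K ^ length js * \<bar>t\<bar> ^ sum_list (map wt js)"
    if "set js \<subseteq> J" "t \<in> X" for js t
    using that(1)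
  proof (induction js)
    case (Cons j js)
    have "\<bar>\<gamma> t j\<bar> \<le> K * \<bar>t\<bar> ^ wt j"
    proof (cases j)
      case (Inl r)
      have "\<bar>t\<bar> ^ r / fact r \<le> \<bar>t\<bar> ^ r / 1" by (intro divide_left_mono) (auto simp: fact_ge_1)
      also have "\<dots> \<le> K * \<bar>t\<bar> ^ r" using mult_right_mono[OF K, of "\<bar>t\<bar> ^ r"] by simp
      finally show ?thesis by (simp add: Inl \<gamma>_def wt_def power_abs)
    next
      case (Inr b)
      then show ?thesis using \<beta>[of b t] that(2) Cons.prems by (auto simp: \<gamma>_def wt_def J_def)
    qed
    then have "\<bar>\<gamma> t j\<bar> * \<bar>prod_list (map (\<gamma> t) js)\<bar> \<le> (K * \<bar>t\<bar> ^ wt j) * (K ^ length js * \<bar>t\<bar> ^ sum_list (map wt js))"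
      using Cons K by (intro mult_mono) auto
    then show ?case by (simp add: abs_mult power_add mult_ac)
  qed simp
  \<comment> \<open>Words of pure Taylor letters contribute exact monomials, collected in
    \<open>Q\<close>; \<open>D\<close> bounds all words with a remainder letter.\<close>
  define Q where "Q = (\<Sum>p\<le>n. \<Sum>rs\<in>Lp p. monom (T (map v rs) / (fact p * prod_list (map fact rs))) (sum_list rs))"
  define D where "D = (\<Sum>p\<le>n. \<Sum>js\<in>Jp p - map Inl ` Lp p. K ^ p * \<bar>T (map x js)\<bar>)"
  have "\<bar>poly Q t\<bar> \<le> (C + D) * \<bar>t\<bar> ^ Suc n" if t: "t \<in> X" for t
  proof -
    define rest where "rest p = (\<Sum>js\<in>Jp p - map Inl ` Lp p. prod_list (map (\<gamma> t) js) * T (map x js))" for p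
    have Tp: "T (replicate p (h t)) = (\<Sum>rs\<in>Lp p. (t ^ sum_list rs / prod_list (map fact rs)) * T (map v rs)) + rest p" for p
    proof -
      have "T (replicate p (h t)) = (\<Sum>js\<in>Jp p. prod_list (map (\<gamma> t) js) * T (map x js))"
        using multilinear_expand[OF T J, of "[]" p "\<gamma> t" x "[]"] by (simp add: hx[OF t] Jp_def)
      also have "\<dots> = rest p + (\<Sum>js\<in>map Inl ` Lp p. prod_list (map (\<gamma> t) js) * T (map x js))"
        unfolding rest_def using fin sub by (intro sum.subset_diff) auto
      also have "(\<Sum>js\<in>map Inl ` Lp p. prod_list (map (\<gamma> t) js) * T (map x js)) =
          (\<Sum>rs\<in>Lp p. prod_list (map (\<gamma> t \<circ> Inl) rs) * T (map (x \<circ> Inl) rs))"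
        by (subst sum.reindex) (auto intro: inj_on_subset[of _ UNIV])
      also have "\<dots> = (\<Sum>rs\<in>Lp p. (t ^ sum_list rs / prod_list (map fact rs)) * T (map v rs))"
      proof (rule sum.cong)
        fix rs :: "nat list"
        have "prod_list (map (\<gamma> t \<circ> Inl) rs) = t ^ sum_list rs / prod_list (map fact rs)"
          by (induction rs) (auto simp: \<gamma>_def power_add)
        moreover have "x \<circ> Inl = v" by (auto simp: x_def)
        ultimately show "prod_list (map (\<gamma> t \<circ> Inl) rs) * T (map (x \<circ> Inl) rs) =
            (t ^ sum_list rs / prod_list (map fact rs)) * T (map v rs)" by simp
      qed simp
      finally show ?thesis by simp
    qed
    have rest: "\<bar>rest p / fact p\<bar> \<le> (\<Sum>js\<in>Jp p - map Inl ` Lp p. K ^ p * \<bar>T (map x js)\<bar>) * \<bar>t\<bar> ^ Suc n" for p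
    proof -
      have "\<bar>rest p / fact p\<bar> \<le> \<bar>rest p\<bar> / 1"
        unfolding abs_divide by (intro divide_left_mono) (auto simp: fact_ge_1)
      also have "\<dots> \<le> (\<Sum>js\<in>Jp p - map Inl ` Lp p. \<bar>prod_list (map (\<gamma> t) js) * T (map x js)\<bar>)"
        unfolding rest_def by (simp add: sum_abs)
      also have "\<dots> \<le> (\<Sum>js\<in>Jp p - map Inl ` Lp p. K ^ p * \<bar>T (map x js)\<bar> * \<bar>t\<bar> ^ Suc n)"
      proof (rule sum_mono)
        fix js assume js: "js \<in> Jp p - map Inl ` Lp p"
        have "\<exists>b. Inr b \<in> set js"
        proof (rule ccontr)
          assume "\<nexists>b. Inr b \<in> set js"
          then have all: "\<forall>j\<in>set js. \<exists>r\<in>{1..n}. j = Inl r"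
            using js by (auto simp: Jp_def J_def Plus_def)
          have "map Inl (map projl js) = js" unfolding map_map using all by (intro map_idI) auto
          moreover have "map projl js \<in> Lp p" using all js by (force simp: Lp_def Jp_def)
          ultimately have "js \<in> map Inl ` Lp p" by (metis imageI)
          then show False using js by blast
        qed
        then obtain b where "Inr b \<in> set js" by blast
        then have "wt (Inr b) \<le> sum_list (map wt js)" by (intro member_le_sum_list) auto
        then have "\<bar>t\<bar> ^ sum_list (map wt js) \<le> \<bar>t\<bar> ^ Suc n"
          using X(2)[OF t] by (intro power_decreasing) (auto simp: wt_def)
        then have "K ^ p * \<bar>t\<bar> ^ sum_list (map wt js) \<le> K ^ p * \<bar>t\<bar> ^ Suc n"
          using K by (intro mult_left_mono) auto
        then have "\<bar>prod_list (map (\<gamma> t) js)\<bar> \<le> K ^ p * \<bar>t\<bar> ^ Suc n"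
          using wt_bd[of js t] js t by (force simp: Jp_def)
        then have "\<bar>prod_list (map (\<gamma> t) js)\<bar> * \<bar>T (map x js)\<bar> \<le> (K ^ p * \<bar>t\<bar> ^ Suc n) * \<bar>T (map x js)\<bar>"
          by (rule mult_right_mono) simp
        then show "\<bar>prod_list (map (\<gamma> t) js) * T (map x js)\<bar> \<le> K ^ p * \<bar>T (map x js)\<bar> * \<bar>t\<bar> ^ Suc n"
          by (simp add: abs_mult mult_ac)
      qed
      finally show ?thesis by (simp only: sum_distrib_right)
    qed
    have "(\<Sum>p\<le>n. T (replicate p (h t)) / fact p) = poly Q t + (\<Sum>p\<le>n. rest p / fact p)"
      unfolding Q_def poly_sum poly_monom Tp add_divide_distrib sum.distrib sum_divide_distrib
      by (simp add: mult_ac)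
    moreover have "\<bar>\<Sum>p\<le>n. rest p / fact p\<bar> \<le> D * \<bar>t\<bar> ^ Suc n"
      unfolding D_def sum_distrib_right[of _ "{..n}"]
      by (rule order_trans[OF sum_abs]) (intro sum_mono rest)
    ultimately show ?thesis using flat[OF t] unfolding distrib_right by linarith
  qed
  then have "coeff Q n = 0" by (intro poly_coeff_zero_of_flat[OF X(1)]) auto
  moreover have "coeff Q n = (\<Sum>p\<le>n. \<Sum>rs\<in>{rs. set rs \<subseteq> {1..n} \<and> length rs = p \<and> sum_list rs = n}.
            T (map v rs) / (fact p * prod_list (map fact rs)))"
  proof -
    have "{rs. set rs \<subseteq> {1..n} \<and> length rs = p \<and> sum_list rs = n} = {rs\<in>Lp p. sum_list rs = n}" for p
      by (auto simp: Lp_def)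
    then show ?thesis unfolding Q_def using fin
      by (simp add: coeff_sum sum.inter_filter cong: if_cong)
  qed
  ultimately show ?thesis by simp
qed

section \<open>Deformations of Maurer--Cartan elements\<close>

lemma has_derivative_linear_deriv_tower:
  fixes \<phi> :: "'v::real_normed_vector \<Rightarrow> real"
  assumes lin: "linear \<phi>" and f: "deriv_tower I f" and t: "t \<in> I"
  shows "((\<lambda>s. \<phi> (f n s)) has_field_derivative \<phi> (f (Suc n) t)) (at t within I)"
proof -
  have "((\<lambda>s. \<phi> ((1 / (s - t)) *\<^sub>R (f n s - f n t))) \<longlongrightarrow> \<phi> (f (Suc n) t)) (at t within I)"
    using f t unfolding deriv_tower_def by (intro limitin_ftop_linear[OF lin]) blast
  then show ?thesis
    by (simp add: has_field_derivative_iff linear_scale[OF lin] linear_diff[OF lin])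
qed

text \<open>Convergence of the first difference quotient at 0 confines \<open>f 0\<close> to a
  finite-dimensional space near 0. The higher derivatives stay in the same span on the same
  neighbourhood, because functionals vanishing on a subspace vanish on limits of difference
  quotients formed in it.\<close>

lemma deriv_tower_locally_finite_dim:
  fixes f :: "nat \<Rightarrow> real \<Rightarrow> 'v::real_normed_vector"
  assumes f: "deriv_tower I f" and I: "is_interval I" "0 \<in> I" "\<exists>t\<in>I. t \<noteq> 0"
    and W: "subspace W" "\<And>t. t \<in> I \<Longrightarrow> f 0 t \<in> W"
  obtains B d where "finite B" "independent B" "B \<subseteq> W" "0 < d"
    "\<And>r t. t \<in> I \<Longrightarrow> \<bar>t\<bar> < d \<Longrightarrow> f r t \<in> span B"
proof -
  have "limitin ftop (\<lambda>s. (1 / (s - 0)) *\<^sub>R (f 0 s - f 0 0)) (f (Suc 0) 0) (at 0 within I)"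
    using f I(2) unfolding deriv_tower_def by blast
  then obtain B0 d where B0: "finite B0" "0 < d"
    "\<And>s. s \<in> I \<Longrightarrow> s \<noteq> 0 \<Longrightarrow> \<bar>s - 0\<bar> < d \<Longrightarrow> (1 / (s - 0)) *\<^sub>R (f 0 s - f 0 0) \<in> span B0"
    using limitin_ftop_locally_finite_dim by blast
  \<comment> \<open>Intersecting with \<open>W\<close> provides basis vectors inside
    \<open>W\<close>, which will be the degree-zero part.\<close>
  let ?U = "span (insert (f 0 0) B0) \<inter> W"
  have f0: "f 0 s \<in> ?U" if "s \<in> I" "\<bar>s\<bar> < d" for s
  proof (cases "s = 0")
    case False
    have "f 0 s = f 0 0 + s *\<^sub>R ((1 / (s - 0)) *\<^sub>R (f 0 s - f 0 0))" using False by simp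
    also have "\<dots> \<in> span (insert (f 0 0) B0)"
    proof (rule span_add)
      have "(1 / (s - 0)) *\<^sub>R (f 0 s - f 0 0) \<in> span B0" using B0(3)[OF that(1) False] that(2) by simp
      then show "s *\<^sub>R (1 / (s - 0)) *\<^sub>R (f 0 s - f 0 0) \<in> span (insert (f 0 0) B0)"
        using span_mono[of B0 "insert (f 0 0) B0"] span_scale by blast
    qed (simp add: span_base)
    finally show ?thesis using W(2) that by blast
  qed (use W(2) I(2) in \<open>auto intro: span_base\<close>)
  have sU: "subspace ?U" by (intro subspace_inter subspace_span W)
  obtain B where B: "B \<subseteq> ?U" "independent B" "?U \<subseteq> span B"
    using maximal_independent_subset[of ?U] by blast
  have finB: "finite B"
    using independent_span_bound[of "insert (f 0 0) B0" B] B0(1) B by auto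
  obtain \<psi> :: "'v \<Rightarrow> 'v \<Rightarrow> real" where \<psi>: "\<And>c. linear (\<psi> c)" "\<And>v. v \<in> span B \<Longrightarrow> v = (\<Sum>c\<in>B. \<psi> c v *\<^sub>R c)"
    using dual_coordinates[OF B(2) finB] by blast
  have "f r t \<in> span B" if "t \<in> I" "\<bar>t\<bar> < d" for r t
    using that
  proof (induction r arbitrary: t)
    case 0
    then show ?case using f0 B(3) by blast
  next
    case (Suc r)
    have "f (Suc r) t = (\<Sum>c\<in>B. \<psi> c (f (Suc r) t) *\<^sub>R c)"
    proof (rule linear_functionals_separate)
      fix \<eta> :: "'v \<Rightarrow> real" assume \<eta>: "linear \<eta>"
      \<comment> \<open>\<open>\<xi>\<close> is \<eta> minus its composite with the coordinate
        projection to span B. It vanishes on span B, hence along \<open>f r\<close> near t, hence on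
        the derivative.\<close>
      define \<xi> where "\<xi> v = \<eta> v - (\<Sum>c\<in>B. \<psi> c v * \<eta> c)" for v
      have \<xi>: "linear \<xi>"
        unfolding \<xi>_def using \<eta> \<psi>(1)
        by (intro linearI)
          (auto simp: linear_add linear_scale algebra_simps sum.distrib sum_distrib_left)
      have zero: "\<xi> v = 0" if "v \<in> span B" for v
        using arg_cong[OF \<psi>(2)[OF that], of \<eta>]
        by (simp add: \<xi>_def linear_sum[OF \<eta>] linear_scale[OF \<eta>])
      have "((\<lambda>s. (\<xi> (f r s) - \<xi> (f r t)) / (s - t)) \<longlongrightarrow> \<xi> (f (Suc r) t)) (at t within I)"
        using has_derivative_linear_deriv_tower[OF \<xi> f Suc.prems(1)] by (simp add: has_field_derivative_iff)
      moreover have "\<forall>\<^sub>F s in at t within I. (\<xi> (f r s) - \<xi> (f r t)) / (s - t) = 0"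
        unfolding eventually_at
      proof (intro exI[of _ "d - \<bar>t\<bar>"] conjI ballI impI)
        fix s assume "s \<in> I" "s \<noteq> t \<and> dist s t < d - \<bar>t\<bar>"
        then have "f r s \<in> span B" by (intro Suc.IH) (auto simp: dist_real_def)
        then show "(\<xi> (f r s) - \<xi> (f r t)) / (s - t) = 0" using Suc zero by simp
      qed (use Suc.prems in simp)
      then have "((\<lambda>s. (\<xi> (f r s) - \<xi> (f r t)) / (s - t)) \<longlongrightarrow> 0) (at t within I)"
        by (rule tendsto_eventually)
      moreover have "at t within I \<noteq> bot"
      proof -
        have "connected I" using I(1) by (rule is_interval_connected)
        moreover have "\<nexists>y. I = {y}" using I(2,3) by auto
        ultimately have "t islimpt I" using Suc.prems(1) connected_imp_perfect by blast
        then show ?thesis by (simp add: trivial_limit_within)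
      qed
      ultimately have "\<xi> (f (Suc r) t) = 0" using tendsto_unique by blast
      then show "\<eta> (f (Suc r) t) = \<eta> (\<Sum>c\<in>B. \<psi> c (f (Suc r) t) *\<^sub>R c)"
        by (simp add: \<xi>_def linear_sum[OF \<eta>] linear_scale[OF \<eta>])
    qed
    also have "\<dots> \<in> span B" by (intro span_sum span_scale span_base)
    finally show ?case .
  qed
  then show thesis using that finB B B0(2) by blast
qed

section \<open>Scalar-valued brackets and their convergence near a point of
  \<open>D_ell\<close>\<close>

definition scalar_bracket :: "('v \<Rightarrow> real) \<Rightarrow> (nat \<Rightarrow> 'v list \<Rightarrow> 'v) \<Rightarrow> 'v list \<Rightarrow> real" where
  "scalar_bracket \<phi> L xs = \<phi> (L (length xs) xs)"

lemma multilinear_scalar_bracket: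
  fixes V :: "int \<Rightarrow> 'v::real_vector set"
  assumes L: "L_infty V L" and \<phi>: "linear \<phi>"
  shows "multilinear (scalar_bracket \<phi> L)"
  unfolding multilinear_def
proof (intro allI)
  fix xs ys :: "'v list" and a b :: real and y z :: 'v
  let ?n = "length xs + Suc (length ys)"
  have "\<forall>k xs j a b y z. length xs = k \<and> j < k \<longrightarrow>
        L k (xs[j := a *\<^sub>R y + b *\<^sub>R z]) = a *\<^sub>R L k (xs[j := y]) + b *\<^sub>R L k (xs[j := z])"
    using L unfolding L_infty_def by (elim conjE)
  from this[rule_format, of "xs @ y # ys" ?n "length xs" a y b z]
  have "L ?n (xs @ (a *\<^sub>R y + b *\<^sub>R z) # ys) = a *\<^sub>R L ?n (xs @ y # ys) + b *\<^sub>R L ?n (xs @ z # ys)"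
    by simp
  moreover have "\<phi> (a *\<^sub>R p + b *\<^sub>R q) = a * \<phi> p + b * \<phi> q" for p q
    by (simp add: linear_add[OF \<phi>] linear_scale[OF \<phi>])
  ultimately have "\<phi> (L ?n (xs @ (a *\<^sub>R y + b *\<^sub>R z) # ys)) =
      a * \<phi> (L ?n (xs @ y # ys)) + b * \<phi> (L ?n (xs @ z # ys))"
    by (rule ssubst)
  then show "scalar_bracket \<phi> L (xs @ (a *\<^sub>R y + b *\<^sub>R z) # ys) =
      a * scalar_bracket \<phi> L (xs @ y # ys) + b * scalar_bracket \<phi> L (xs @ z # ys)"
    by (simp only: scalar_bracket_def length_append list.size(4) add_Suc_right add_0_right plus_nat.add_0 One_nat_def)
qed

lemma symmetric_on_scalar_bracket:
  fixes V :: "int \<Rightarrow> 'v::real_vector set"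
  assumes L: "L_infty V L"
  shows "symmetric_on (V 0) (scalar_bracket \<phi> L)"
  unfolding symmetric_on_def
proof (intro allI ballI)
  fix xs ys :: "'v list" and x y assume xy: "x \<in> V 0" "y \<in> V 0"
  let ?n = "length xs + Suc (Suc (length ys))"
  have "\<forall>k xs j d e. length xs = k \<and> Suc j < k \<and> xs ! j \<in> V d \<and> xs ! Suc j \<in> V e \<longrightarrow>
        L k (xs[j := xs ! Suc j, Suc j := xs ! j]) = (if odd (d * e) then -1 else 1) *\<^sub>R L k xs"
    using L unfolding L_infty_def by (elim conjE)
  from this[rule_format, of "xs @ x # y # ys" ?n "length xs" 0 0] xy
  have "L ?n (xs @ y # x # ys) = L ?n (xs @ x # y # ys)"
    by (simp add: nth_append list_update_append)
  then show "scalar_bracket \<phi> L (xs @ x # y # ys) = scalar_bracket \<phi> L (xs @ y # x # ys)"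
    by (simp add: scalar_bracket_def)
qed

text \<open>Limits in \<open>ftop\<close> are unique, since linear functionals are continuous and
  separate points. The definite description in \<open>tw\<close> therefore denotes the actual limit,
  and applying \<phi> gives an ordinary real series.\<close>

lemma twist_term_sums_tw:
  assumes u: "u \<in> conv_set V L" and \<phi>: "linear \<phi>"
  shows "twist_term (scalar_bracket \<phi> L) u vs sums \<phi> (tw L u (length vs) vs)"
proof -
  let ?X = "tw_partial L u (length vs) vs"
  obtain s where s: "limitin ftop ?X s sequentially" using u unfolding conv_set_def by blast
  have "s' = s" if s': "limitin ftop ?X s' sequentially" for s'
    using LIMSEQ_unique[OF limitin_ftop_linear[OF _ s'] limitin_ftop_linear[OF _ s]]
    by (rule linear_functionals_separate)
  then have "tw L u (length vs) vs = s" unfolding tw_def using s by blast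
  moreover have "\<phi> (?X n) = (\<Sum>k<n. twist_term (scalar_bracket \<phi> L) u vs k)" for n
    by (simp add: tw_partial_def linear_sum[OF \<phi>] linear_scale[OF \<phi>] twist_term_def scalar_bracket_def add.commute)
  ultimately show ?thesis using limitin_ftop_linear[OF \<phi> s] by (simp add: sums_def)
qed

lemma D_ell_subset_conv_set: "D_ell V L \<subseteq> conv_set V L"
  unfolding D_ell_def by (rule interior_of_subset)

text \<open>Openness is tested on the span of u and the vectors \<open>x j\<close>, where it yields
  a norm ball around u. Small displacements and a scaling slightly above 1 together stay in that
  ball.\<close>

lemma D_ell_box:
  fixes x :: "'j \<Rightarrow> 'v::real_normed_vector"
  assumes u: "u \<in> D_ell V L" and V0: "subspace (V 0)" and J: "finite J" "\<And>j. j \<in> J \<Longrightarrow> x j \<in> V 0"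
  obtains R c where "0 < R" "1 < c"
    "\<And>s. (\<And>j. j \<in> J \<Longrightarrow> \<bar>s j\<bar> \<le> R) \<Longrightarrow> c *\<^sub>R (u + (\<Sum>j\<in>J. s j *\<^sub>R x j)) \<in> conv_set V L"
proof -
  have "openin (subtopology ftop (V 0)) (D_ell V L)" unfolding D_ell_def by simp
  then obtain U where U: "fin_open U" "D_ell V L = U \<inter> V 0"
    by (auto simp: openin_subtopology openin_ftop)
  let ?B = "insert u (x ` J)"
  have uV: "u \<in> V 0" using u U by blast
  have "finite ?B" using J(1) by simp
  then have op: "openin (top_of_set (span ?B)) (U \<inter> span ?B)"
    by (rule U(1)[unfolded fin_open_def, rule_format])
  have "u \<in> U \<inter> span ?B" using u U(2) by (simp add: span_base)
  then have "\<exists>\<rho>>0. \<forall>w\<in>span ?B. dist w u < \<rho> \<longrightarrow> w \<in> U \<inter> span ?B"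
    by (rule op[unfolded openin_euclidean_subtopology_iff, THEN conjunct2, rule_format])
  then obtain \<rho> where "0 < \<rho>" "\<forall>w\<in>span ?B. dist w u < \<rho> \<longrightarrow> w \<in> U \<inter> span ?B"
    by (elim exE conjE)
  then have \<rho>: "0 < \<rho>" "\<And>w. w \<in> span ?B \<Longrightarrow> dist w u < \<rho> \<Longrightarrow> w \<in> U" by blast+
  define M where "M = (\<Sum>j\<in>J. norm (x j)) + norm u + 1"
  have sum0: "0 \<le> (\<Sum>j\<in>J. norm (x j))" by (simp add: sum_nonneg)
  then have M: "0 < M" by (simp add: M_def add_nonneg_pos)
  \<comment> \<open>e is both the radius of the box and the excess of the scaling factor over 1. The
    total displacement is at most 2 e M \<le> \<rho> / 2, where e \<le> 1 bounds the factor 1 + e by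
    2.\<close>
  define e where "e = min 1 (\<rho> / (4 * M))"
  have e: "0 < e" "e \<le> 1" "e * M \<le> \<rho> / 4" using \<rho>(1) M by (auto simp: e_def min_def field_simps)
  show thesis
  proof (rule that[of e "1 + e"])
    fix s assume s: "\<And>j. j \<in> J \<Longrightarrow> \<bar>s j\<bar> \<le> e"
    define h where "h = (\<Sum>j\<in>J. s j *\<^sub>R x j)"
    have "norm h \<le> (\<Sum>j\<in>J. e * norm (x j))"
      unfolding h_def using s by (intro sum_norm_le) (auto intro: mult_right_mono)
    then have h: "norm h \<le> e * (\<Sum>j\<in>J. norm (x j))" by (simp add: sum_distrib_left)
    let ?w = "(1 + e) *\<^sub>R (u + h)"
    have w_span: "?w \<in> span ?B"
      unfolding h_def by (intro span_scale span_add span_sum) (auto intro: span_base)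
    have w_V: "?w \<in> V 0"
      unfolding h_def using V0 uV J(2) by (intro subspace_scale subspace_add subspace_sum) auto
    have "dist ?w u = norm (e *\<^sub>R u + (1 + e) *\<^sub>R h)"
      by (simp add: dist_norm algebra_simps)
    also have "\<dots> \<le> e * norm u + (1 + e) * norm h"
      using norm_triangle_ineq[of "e *\<^sub>R u" "(1 + e) *\<^sub>R h"] e by simp
    also have "\<dots> \<le> e * norm u + 2 * (e * (\<Sum>j\<in>J. norm (x j)))"
      using e h by (intro add_left_mono mult_mono) auto
    also have "\<dots> \<le> 2 * (e * M)" using e sum0 by (simp add: M_def algebra_simps)
    also have "\<dots> < \<rho>" using e(3) \<rho>(1) by simp
    finally have "?w \<in> D_ell V L" using \<rho>(2)[OF w_span] w_V U(2) by blast
    then show "(1 + e) *\<^sub>R (u + (\<Sum>j\<in>J. s j *\<^sub>R x j)) \<in> conv_set V L" using D_ell_subset_conv_set unfolding h_def by blast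
  qed (use e in auto)
qed

lemma twist_term_geometric_on_box:
  fixes x :: "'j \<Rightarrow> 'v::real_normed_vector"
  assumes L: "L_infty V L" and u: "u \<in> D_ell V L" and J: "finite J" "\<And>j. j \<in> J \<Longrightarrow> x j \<in> V 0"
    and V0: "subspace (V 0)" and \<phi>: "linear \<phi>"
  obtains r \<theta> where "0 < r" "0 < \<theta>" "\<theta> < 1"
    "\<And>vs. \<exists>C. \<forall>s k. (\<forall>j\<in>J. \<bar>s j\<bar> \<le> r) \<longrightarrow>
      \<bar>twist_term (scalar_bracket \<phi> L) (u + (\<Sum>j\<in>J. s j *\<^sub>R x j)) vs k\<bar> \<le> C * \<theta> ^ k"
proof -
  let ?A = "scalar_bracket \<phi> L"
  have A: "multilinear ?A" using L \<phi> by (rule multilinear_scalar_bracket)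
  obtain R c where R: "0 < R" and c: "1 < c"
    and conv: "\<And>s. (\<And>j. j \<in> J \<Longrightarrow> \<bar>s j\<bar> \<le> R) \<Longrightarrow> c *\<^sub>R (u + (\<Sum>j\<in>J. s j *\<^sub>R x j)) \<in> conv_set V L"
    using D_ell_box[of u V L J x, OF u V0 J] by blast
  \<comment> \<open>The midpoint between the pointwise rate 1 / c and 1 leaves room for the loss in
    \<open>twist_term_box_bound\<close>.\<close>
  define \<theta> where "\<theta> = (1 / c + 1) / 2"
  have \<theta>: "1 / c < \<theta>" "\<theta> < 1" "0 < \<theta>" using c by (auto simp: \<theta>_def field_simps add_pos_pos)
  show thesis
  proof (rule that[of "R / 2" \<theta>])
    fix vs
    show "\<exists>C. \<forall>s k. (\<forall>j\<in>J. \<bar>s j\<bar> \<le> R / 2) \<longrightarrow>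
      \<bar>twist_term ?A (u + (\<Sum>j\<in>J. s j *\<^sub>R x j)) vs k\<bar> \<le> C * \<theta> ^ k"
    proof (rule twist_term_box_bound[OF A J(1) R _ \<theta>(1)])
      fix s assume s: "\<And>j. j \<in> J \<Longrightarrow> \<bar>s j\<bar> \<le> R"
      let ?w = "u + (\<Sum>j\<in>J. s j *\<^sub>R x j)"
      have "summable (twist_term ?A (c *\<^sub>R ?w) vs)"
        using twist_term_sums_tw[OF conv[OF s] \<phi>] by (rule sums_summable)
      \<comment> \<open>Terms of a convergent series are bounded, and the k-th term is homogeneous
        of degree k in the twisting element. A bound at c w thus becomes decay like c^(-k) at
        w.\<close>
      then have "Bseq (twist_term ?A (c *\<^sub>R ?w) vs)"
        using summable_LIMSEQ_zero convergent_def convergent_imp_Bseq by blast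
      then obtain C where C: "\<And>k. \<bar>twist_term ?A (c *\<^sub>R ?w) vs k\<bar> \<le> C"
        unfolding Bseq_def by auto
      have "twist_term ?A (c *\<^sub>R ?w) vs k = c ^ k * twist_term ?A ?w vs k" for k
        using multilinear_scale_replicate[OF A, of "[]" k c ?w vs] by (simp add: twist_term_def)
      then have "\<bar>twist_term ?A ?w vs k\<bar> \<le> C * (1 / c) ^ k" for k
        using C[of k] c by (simp add: abs_mult power_one_over field_simps)
      then show "\<exists>C. \<forall>k. \<bar>twist_term ?A ?w vs k\<bar> \<le> C * (1 / c) ^ k" by blast
    qed (use c in simp)
  qed (use R \<theta> in auto)
qed

text \<open>The left-hand side is the coefficient of t^n in the formal expansion of \<phi> (MC
  (u_t)) at t = 0, with the derivatives of the path at 0 as data.\<close>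

lemma scalar_obstruction_identity:
  fixes V :: "int \<Rightarrow> 'v::real_normed_vector set" and \<phi> :: "'v \<Rightarrow> real"
  assumes L: "L_infty V L" and u: "deformation V L u0 I u" and \<phi>: "linear \<phi>" and n: "1 \<le> n"
  shows "(\<Sum>p\<le>n. \<Sum>rs\<in>{rs. set rs \<subseteq> {1..n} \<and> length rs = p \<and> sum_list rs = n}.
    \<phi> (tw L u0 p (map (\<lambda>r. u r 0) rs)) / (fact p * prod_list (map fact rs))) = 0"
proof -
  let ?A = "scalar_bracket \<phi> L"
  have V0: "subspace (V 0)" using L by (auto simp: L_infty_def graded_space_def)
  have I: "is_interval I" "0 \<in> I" "\<exists>t\<in>I. t \<noteq> 0" and tower: "deriv_tower I u"
    and D: "\<And>t. t \<in> I \<Longrightarrow> u 0 t \<in> D_ell V L" and mc: "\<And>t. t \<in> I \<Longrightarrow> MC L (u 0 t) = 0" and u0: "u 0 0 = u0"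
    using u by (auto simp: deformation_def)
  note Dsub = D_ell_subset_conv_set[of V L]
  have inV: "u 0 t \<in> V 0" if "t \<in> I" for t using D[OF that] Dsub by (auto simp: conv_set_def)
  obtain B d where B: "finite B" "independent B" "B \<subseteq> V 0" and d: "0 < d"
    and span: "\<And>r t. t \<in> I \<Longrightarrow> \<bar>t\<bar> < d \<Longrightarrow> u r t \<in> span B"
    using deriv_tower_locally_finite_dim[OF tower I V0 inV] by blast
  obtain \<psi> :: "'v \<Rightarrow> 'v \<Rightarrow> real" where \<psi>: "\<And>b. linear (\<psi> b)" "\<And>v. v \<in> span B \<Longrightarrow> v = (\<Sum>b\<in>B. \<psi> b v *\<^sub>R b)"
    using dual_coordinates[OF B(2,1)] by blast
  have u0D: "u0 \<in> D_ell V L" "u0 \<in> V 0" using D inV I(2) u0 by auto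
  obtain r \<theta> where r: "0 < r" and \<theta>: "0 < \<theta>" "\<theta> < 1" and box: "\<And>vs. \<exists>C. \<forall>s k. (\<forall>b\<in>B. \<bar>s b\<bar> \<le> r) \<longrightarrow>
      \<bar>twist_term ?A (u0 + (\<Sum>b\<in>B. s b *\<^sub>R b)) vs k\<bar> \<le> C * \<theta> ^ k"
    using twist_term_geometric_on_box[of V L u0 B "\<lambda>b. b", OF L u0D(1) B(1) _ V0 \<phi>] B(3) by blast
  define T where "T vs = suminf (twist_term ?A u0 vs)" for vs
  have u0conv: "u0 \<in> conv_set V L" using u0D Dsub by blast
  have T_tw: "T vs = \<phi> (tw L u0 (length vs) vs)" for vs
    using twist_term_sums_tw[OF u0conv \<phi>, of vs] by (simp add: T_def sums_iff)
  have T: "multilinear T"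
    unfolding T_def
    using sums_summable[OF twist_term_sums_tw[OF u0conv \<phi>]]
    by (intro multilinear_twist multilinear_scalar_bracket[OF L \<phi>])
  obtain C where C: "\<And>\<gamma> \<tau>. (\<And>b. b \<in> B \<Longrightarrow> \<bar>\<gamma> b\<bar> \<le> \<tau>) \<Longrightarrow> 0 \<le> \<tau> \<Longrightarrow> \<tau> \<le> r \<Longrightarrow>
    \<bar>suminf (twist_term ?A (u0 + (\<Sum>b\<in>B. \<gamma> b *\<^sub>R b)) [])
      - (\<Sum>p\<le>n. T (replicate p (\<Sum>b\<in>B. \<gamma> b *\<^sub>R b)) / fact p)\<bar> \<le> C * \<tau> ^ Suc n"
    unfolding T_def
    using twist_taylor_bound[OF multilinear_scalar_bracket[OF L \<phi>] symmetric_on_scalar_bracket[OF L] V0 u0D(2) _ B(1) \<theta> box, of n] B(3)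
    by blast
  have deriv: "((\<lambda>s. \<psi> b (u m s)) has_field_derivative \<psi> b (u (Suc m) t)) (at t within I)" if "t \<in> I" for b m t
    using has_derivative_linear_deriv_tower[OF \<psi>(1) tower that] .
  \<comment> \<open>A common bound near 0 for all coordinates of the derivatives up to order n + 1.
    Each is differentiable and so locally bounded, and only finitely many occur.\<close>
  have "\<exists>e>0. \<exists>M. \<forall>b\<in>B. \<forall>m\<le>Suc n. \<forall>t\<in>I. \<bar>t\<bar> < e \<longrightarrow> \<bar>\<psi> b (u m t)\<bar> \<le> M"
  proof -
    have "\<exists>e>0. \<forall>t\<in>I. \<bar>t\<bar> < e \<longrightarrow> \<bar>\<psi> b (u m t)\<bar> \<le> \<bar>\<psi> b (u m 0)\<bar> + 1" for b m
    proof -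
      have "continuous (at 0 within I) (\<lambda>s. \<psi> b (u m s))"
        using deriv[OF I(2)] by (rule DERIV_continuous)
      then obtain e where "0 < e" "\<forall>t\<in>I. dist t 0 < e \<longrightarrow> dist (\<psi> b (u m t)) (\<psi> b (u m 0)) < 1"
        unfolding continuous_within_eps_delta by (meson zero_less_one)
      then show ?thesis by (intro exI[of _ e]) (force simp: dist_real_def)
    qed
    then obtain e where e: "\<And>b m. 0 < e b m"
      "\<And>b m t. t \<in> I \<Longrightarrow> \<bar>t\<bar> < e b m \<Longrightarrow> \<bar>\<psi> b (u m t)\<bar> \<le> \<bar>\<psi> b (u m 0)\<bar> + 1" by metis
    let ?P = "B \<times> {..Suc n}"
    define e0 where "e0 = Min (insert 1 ((\<lambda>(b, m). e b m) ` ?P))"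
    have "0 < e0" unfolding e0_def using B(1) e(1) by (subst Min_gr_iff) auto
    moreover have "e0 \<le> e b m" if "b \<in> B" "m \<le> Suc n" for b m
      unfolding e0_def using B(1) that by (intro Min_le) auto
    moreover have "\<bar>\<psi> b (u m 0)\<bar> + 1 \<le> (\<Sum>(b, m)\<in>?P. \<bar>\<psi> b (u m 0)\<bar> + 1)" if "b \<in> B" "m \<le> Suc n" for b m
      using member_le_sum[of "(b, m)" ?P "\<lambda>(b, m). \<bar>\<psi> b (u m 0)\<bar> + 1"] B(1) that by auto
    ultimately show ?thesis using e(2) by (meson order_trans less_le_trans)
  qed
  then obtain e M where e: "0 < e" and M: "\<And>b m t. b \<in> B \<Longrightarrow> m \<le> Suc n \<Longrightarrow> t \<in> I \<Longrightarrow> \<bar>t\<bar> < e \<Longrightarrow> \<bar>\<psi> b (u m t)\<bar> \<le> M"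
    by blast
  define K where "K = max 1 \<bar>M\<bar>"
  have K: "1 \<le> K" "M \<le> K" by (auto simp: K_def)
  \<comment> \<open>The four bounds serve, in order, to compare powers of t, to stay in span B, to
    have the derivative bounds, and to keep the coordinates of \<open>h t\<close>, which are at most
    K |t|, inside the box of radius r.\<close>
  define \<epsilon> where "\<epsilon> = Min {1, d, e, r / K}"
  have \<epsilon>: "0 < \<epsilon>" "\<epsilon> \<le> 1" "\<epsilon> \<le> d" "\<epsilon> \<le> e" "\<epsilon> \<le> r / K"
    using d e r K by (auto simp: \<epsilon>_def)
  \<comment> \<open>A convex neighbourhood of 0 within \<open>I\<close>, so that Taylor's formula
    applies on it even if 0 is an endpoint.\<close>
  define X where "X = I \<inter> ball 0 \<epsilon>"
  have X: "t \<in> I" "\<bar>t\<bar> < \<epsilon>" if "t \<in> X" for t using that by (auto simp: X_def dist_real_def)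
  have cX: "convex X" unfolding X_def using I(1) by (intro convex_Int) (auto simp: is_interval_convex)
  have X0: "0 \<in> X" using I(2) \<epsilon> by (simp add: X_def)
  have Xlim: "0 islimpt X"
  proof -
    have "connected I" using I(1) by (rule is_interval_connected)
    moreover have "\<nexists>y. I = {y}" using I(2,3) by auto
    ultimately have "0 islimpt I" using I(2) connected_imp_perfect by blast
    moreover have "\<forall>\<^sub>F y in at 0. y \<in> ball 0 \<epsilon>"
      using \<epsilon>(1) by (intro eventually_at_in_open') auto
    ultimately show ?thesis unfolding X_def by (rule islimpt_Int_eventually)
  qed
  have dX: "((\<lambda>s. \<psi> b (u m s)) has_field_derivative \<psi> b (u (Suc m) t)) (at t within X)" if "t \<in> X" for b m t
    using deriv[OF X(1)[OF that]] by (rule DERIV_subset) (simp add: X_def)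
  have taylor: "\<bar>\<psi> b (u 0 t) - (\<Sum>i\<le>m. \<psi> b (u i 0) * t ^ i / fact i)\<bar> \<le> K * \<bar>t\<bar> ^ Suc m"
    if "b \<in> B" "t \<in> X" "m \<le> n" for b t m
  proof -
    have "norm (\<psi> b (u 0 t) - (\<Sum>i\<le>m. \<psi> b (u i 0) * (t - 0) ^ i / fact i)) \<le> K * norm (t - 0) ^ Suc m / fact m"
    proof (rule field_Taylor[OF cX])
      show "norm (\<psi> b (u (Suc m) s)) \<le> K" if "s \<in> X" for s
        using M[OF \<open>b \<in> B\<close>, of "Suc m" s] X[OF that] \<epsilon> K \<open>m \<le> n\<close> by force
    qed (use dX X0 that in auto)
    also have "\<dots> \<le> K * norm (t - 0) ^ Suc m / 1"
      using K by (intro divide_left_mono) (auto simp: fact_ge_1)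
    finally show ?thesis by simp
  qed
  define h where "h t = u 0 t - u0" for t
  have span0: "u m 0 \<in> span B" for m using span[OF I(2)] d by simp
  have spant: "u m t \<in> span B" if "t \<in> X" for m t using span[of t m] X[OF that] \<epsilon> by simp
  have h_coords: "h t = (\<Sum>b\<in>B. \<psi> b (h t) *\<^sub>R b)" if "t \<in> X" for t
    using spant[OF that] span0[of 0] u0 by (intro \<psi>(2)) (simp add: h_def span_diff)
  have h_small: "\<bar>\<psi> b (h t)\<bar> \<le> K * \<bar>t\<bar>" if "b \<in> B" "t \<in> X" for b t
    using taylor[OF that, of 0] by (simp add: h_def u0 linear_diff[OF \<psi>(1)])
  define \<beta> where "\<beta> b t = \<psi> b (u 0 t) - (\<Sum>i\<le>n. \<psi> b (u i 0) * t ^ i / fact i)" for b t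
  have "(\<Sum>p\<le>n. \<Sum>rs\<in>{rs. set rs \<subseteq> {1..n} \<and> length rs = p \<and> sum_list rs = n}.
            T (map (\<lambda>r. u r 0) rs) / (fact p * prod_list (map fact rs))) = 0"
  proof (rule composite_coefficient_zero[OF T B(1) K(1) Xlim, where h = h and \<beta> = \<beta>])
    show "\<bar>t\<bar> \<le> 1" if "t \<in> X" for t using X[OF that] \<epsilon> by simp
    show "\<bar>\<beta> b t\<bar> \<le> K * \<bar>t\<bar> ^ Suc n" if "b \<in> B" "t \<in> X" for b t
      unfolding \<beta>_def using taylor[OF that] by simp
    show "h t = (\<Sum>i=1..n. (t ^ i / fact i) *\<^sub>R u i 0) + (\<Sum>b\<in>B. \<beta> b t *\<^sub>R b)" if "t \<in> X" for t
    proof -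
      define z where "z = u 0 t - (\<Sum>i\<le>n. (t ^ i / fact i) *\<^sub>R u i 0)"
      have "z \<in> span B" unfolding z_def using spant[OF that] span0
        by (intro span_diff span_sum span_scale)
      then have "z = (\<Sum>b\<in>B. \<psi> b z *\<^sub>R b)" by (rule \<psi>(2))
      moreover have "\<psi> b z = \<beta> b t" for b
        by (simp add: z_def \<beta>_def linear_diff[OF \<psi>(1)] linear_sum[OF \<psi>(1)] linear_scale[OF \<psi>(1)] mult.commute)
      ultimately have "z = (\<Sum>b\<in>B. \<beta> b t *\<^sub>R b)" by simp
      moreover have "(\<Sum>i\<le>n. (t ^ i / fact i) *\<^sub>R u i 0) = u0 + (\<Sum>i=1..n. (t ^ i / fact i) *\<^sub>R u i 0)"
        by (simp add: sum.atMost_shift u0 sum.shift_bounds_cl_Suc_ivl atLeast0AtMost sum.atLeast1_atMost_eq lessThan_Suc_atMost)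
      ultimately show ?thesis by (simp add: h_def z_def algebra_simps)
    qed
    show "\<bar>\<Sum>p\<le>n. T (replicate p (h t)) / fact p\<bar> \<le> (C * K ^ Suc n) * \<bar>t\<bar> ^ Suc n" if t: "t \<in> X" for t
    proof -
      have "K * \<bar>t\<bar> \<le> K * (r / K)" using X(2)[OF t] \<epsilon>(5) K by (intro mult_left_mono) auto
      then have Kt: "K * \<bar>t\<bar> \<le> r" using K by simp
      have "suminf (twist_term ?A (u0 + h t) []) = \<phi> (MC L (u 0 t))"
        using twist_term_sums_tw[of "u 0 t" V L \<phi> "[]"] D[OF X(1)[OF t]] Dsub \<phi>
        by (auto simp: h_def MC_def sums_iff)
      also have "\<dots> = 0" using mc[OF X(1)[OF t]] linear_0[OF \<phi>] by simp
      finally have "suminf (twist_term ?A (u0 + h t) []) = 0" .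
      \<comment> \<open>As the full series is 0, the Taylor estimate bounds the Taylor polynomial
        alone.\<close>
      then show ?thesis
        using C[of "\<lambda>b. \<psi> b (h t)" "K * \<bar>t\<bar>"] h_small[OF _ t] Kt K h_coords[OF t]
        by (simp add: power_mult_distrib mult.assoc mult.left_commute)
    qed
  qed
  then show ?thesis by (simp add: T_tw)
qed

text \<open>Positive entries with sum k + 1 automatically lie in {1..k+1}. With (k + 1)! pulled out,
  the obstruction is the part p \<ge> 2 of the coefficient of t^(k + 1).\<close>

lemma obstruction_as_sum:
  "Obs L f k = fact (k + 1) *\<^sub>R (\<Sum>p=2..k+1. \<Sum>rs\<in>{rs. set rs \<subseteq> {1..k+1} \<and> length rs = p \<and> sum_list rs = k + 1}.
     (1 / (fact p * prod_list (map fact rs))) *\<^sub>R tw L (f 0 0) p (map (\<lambda>r. f r 0) rs))"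
proof -
  have "{rs. length rs = p \<and> (\<forall>r\<in>set rs. 0 < r) \<and> sum_list rs = k + 1} =
      {rs. set rs \<subseteq> {1..k+1} \<and> length rs = p \<and> sum_list rs = k + 1}" for p
    using member_le_sum_list[of _ "_ :: nat list"] by (force simp: Suc_le_eq)
  moreover have "(fact (k + 1) / P * (1 / fact i)) *\<^sub>R z = fact (k + 1) *\<^sub>R (1 / (fact i * P)) *\<^sub>R z"
    for P :: real and i and z :: 'a
    by (simp add: mult.commute del: fact_Suc)
  ultimately show ?thesis unfolding Obs_def by (simp only: scaleR_sum_right)
qed

theorem theorem4p7:
  fixes V :: "int \<Rightarrow> 'v::real_normed_vector set"
    and L :: "nat \<Rightarrow> 'v list \<Rightarrow> 'v"
    and u0 :: 'v
    and I :: "real set"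
    and u :: "nat \<Rightarrow> real \<Rightarrow> 'v"
  assumes "L_infty V L"
    and "MC_element V L u0"
    and "deformation V L u0 I u"
  shows "\<forall>k. Obs L u k \<in> (\<lambda>x. tw L u0 1 [x]) ` V 0"
proof
  fix k
  have u00: "u 0 0 = u0" and I: "is_interval I" "0 \<in> I" "\<exists>t\<in>I. t \<noteq> 0" and tower: "deriv_tower I u"
    using assms(3) by (auto simp: deformation_def)
  have V0: "subspace (V 0)" using assms(1) by (auto simp: L_infty_def graded_space_def)
  have "u 0 t \<in> D_ell V L" if "t \<in> I" for t using assms(3) that by (auto simp: deformation_def)
  then have conv: "u 0 t \<in> conv_set V L" if "t \<in> I" for t using that D_ell_subset_conv_set by blast
  \<comment> \<open>The preimage must have degree zero. The derivative at 0 lies in the span of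
    finitely many degree-zero vectors that contains the path near 0.\<close>
  have uV: "u (k + 1) 0 \<in> V 0"
  proof -
    have "u 0 t \<in> V 0" if "t \<in> I" for t using conv[OF that] by (simp add: conv_set_def)
    then obtain B d where B: "B \<subseteq> V 0" and d: "0 < d"
      and span: "\<And>r t. t \<in> I \<Longrightarrow> \<bar>t\<bar> < d \<Longrightarrow> u r t \<in> span B"
      using deriv_tower_locally_finite_dim[OF tower I V0] by metis
    have "u (k + 1) 0 \<in> span B" using span[OF I(2), of "k + 1"] d by simp
    then show ?thesis by (rule subsetD[OF span_minimal[OF B V0]])
  qed
  have u0conv: "u0 \<in> conv_set V L" using conv[OF I(2)] u00 by simp
  have "Obs L u k = tw L u0 1 [- u (k + 1) 0]"
  proof (rule linear_functionals_separate)
    fix \<phi> :: "'v \<Rightarrow> real" assume \<phi>: "linear \<phi>"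
    define S where "S p = (\<Sum>rs\<in>{rs. set rs \<subseteq> {1..k+1} \<and> length rs = p \<and> sum_list rs = k + 1}.
      \<phi> (tw L u0 p (map (\<lambda>r. u r 0) rs)) / (fact p * prod_list (map fact rs)))" for p
    have "\<phi> (Obs L u k) = fact (k + 1) * (\<Sum>p=2..k+1. S p)"
      unfolding obstruction_as_sum u00 S_def
      by (simp only: linear_sum[OF \<phi>] linear_scale[OF \<phi>] real_scaleR_def times_divide_eq_left mult_1_left)
    moreover have "(\<Sum>p\<le>k+1. S p) = 0"
      unfolding S_def by (rule scalar_obstruction_identity[OF assms(1,3) \<phi>]) simp
    \<comment> \<open>p = 0 contributes nothing, as the empty list does not have sum k + 1, and p =
      1 leaves only the list [k + 1]. For k = 0 the range from 2 is empty.\<close>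
    moreover have "(\<Sum>p\<le>k+1. S p) = S 0 + S 1 + (\<Sum>p=2..k+1. S p)"
    proof -
      have "{..k+1} = insert 0 (insert 1 {2..k+1})" by auto
      then show ?thesis by simp
    qed
    moreover have "S 0 = 0"
    proof -
      have "{rs. set rs \<subseteq> {1..k+1} \<and> length rs = 0 \<and> sum_list rs = k + 1} = {}" by auto
      then show ?thesis unfolding S_def by (simp only: sum.empty)
    qed
    moreover have "S 1 = \<phi> (tw L u0 1 [u (k + 1) 0]) / fact (k + 1)"
    proof -
      have "{rs. set rs \<subseteq> {1..k+1} \<and> length rs = 1 \<and> sum_list rs = k + 1} = {[k + 1]}"
        by (auto simp: length_Suc_conv)
      then show ?thesis unfolding S_def by (simp only:) simp
    qed
    ultimately have "\<phi> (Obs L u k) = fact (k + 1) * (- (\<phi> (tw L u0 1 [u (k + 1) 0]) / fact (k + 1)))"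
      by (simp only: add_0 add_eq_0_iff)
    then have "\<phi> (Obs L u k) = - \<phi> (tw L u0 1 [u (k + 1) 0])"
      by (simp del: fact_Suc)
    \<comment> \<open>\<open>tw\<close> is given by a description, so its oddness in the argument is
      derived from the series.\<close>
    moreover have "\<phi> (tw L u0 1 [- x]) = - \<phi> (tw L u0 1 [x])" for x
    proof -
      have A: "multilinear (scalar_bracket \<phi> L)" using assms(1) \<phi> by (rule multilinear_scalar_bracket)
      have "twist_term (scalar_bracket \<phi> L) u0 [- x] = (\<lambda>j. - twist_term (scalar_bracket \<phi> L) u0 [x] j)"
        using multilinear_scale[OF A, of "replicate _ u0" "-1" x "[]"] by (auto simp: twist_term_def)
      then show ?thesis
        using sums_unique2[OF twist_term_sums_tw[OF u0conv \<phi>, of "[- x]"]]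
          sums_minus[OF twist_term_sums_tw[OF u0conv \<phi>, of "[x]"]] by simp
    qed
    ultimately show "\<phi> (Obs L u k) = \<phi> (tw L u0 1 [- u (k + 1) 0])" by simp
  qed
  then show "Obs L u k \<in> (\<lambda>x. tw L u0 1 [x]) ` V 0"
    using uV subspace_neg[OF V0] by blast
qed

end
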